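(* Let $B$ be a commutative unital complex $C^*$-algebra. Let $H$ be the subset of hermitian elements, and assume there is a subset $C\subset B$ with the following properties: (i) $C+C\subset C$, and $aC\subset C$ for every real $a>0$; (ii) $C$ is closed; (iii) $\overline{C-C}=H$; (iv) at least one of the following holds: (1) $C$ consists of non-negative elements (elements with non-negative spectrum) and if $f\in C$ then $\chi(f):=\frac{2f^2}{1+f^2}$ belongs to $C$; (2) if $f\in C$ then $\gamma(f):=\left(\frac{2f}{1+f}\right)^2$ is well defined and belongs to $C$. Let $X$ be the set of characters of $B$. Endow $X$ with the weak*-topology $\mathscr{T}$ and with the preorder defined by: $x\le y$ if $x(f)\le y(f)$ for every $f\in C$. Then $(X,\mathscr{T},\le)$ is a compact ordered space. Moreover, the Gelfand map $\mathcal{G}:B\to C(X,\mathbb{C})$, $f\mapsto\hat f$, $\hat f(x):=x(f)$, is a bijective unit-preserving $*$-isometry which maps $C$ bijectively onto $C^+(X,\le,\mathbb{R})$.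
   Context: A $C^*$-algebra is a complex Banach $*$-algebra with $\|f^*f\|=\|f\|^2$; unital means that it has a unit $1$ with $\|1\|=1$. An element $f$ is hermitian if $f=f^*$. Closures in $B$ are with respect to the norm, and $C-C=\{f-g: f,g\in C\}$. A character is a non-zero multiplicative linear functional $B\to\mathbb{C}$. In (iv), quotients mean multiplication by the inverse in $B$; "$\gamma(f)$ is well defined" means that $1+f$ is invertible in $B$. A compact ordered space is a triple $(X,\mathscr{T},\le)$ where $(X,\mathscr{T})$ is a compact topological space and $\le$ is an order (reflexive, transitive, antisymmetric relation) whose graph is closed in $X\times X$ with the product topology. A function $f:X\to\mathbb{R}$ is isotone if $x\le y$ implies $f(x)\le f(y)$. $C^+(X,\le,\mathbb{R})$ is the set of non-negative continuous isotone real functions on $X$, regarded as a subset of $C(X,\mathbb{C})$, the $C^*$-algebra of continuous complex functions with sup norm and complex conjugation as involution. A bijective $*$-isometry is a bijective norm-preserving algebra homomorphism commuting with the involutions. *)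

theory Defs
  imports "HOL-Analysis.Analysis" "HOL-Library.Complex_Order"
begin

section \<open>Unital $C^*$-algebras\<close>

text \<open>
  The classes \<^class>\<open>real_normed_algebra_1\<close> and \<^class>\<open>banach\<close> provide the underlying real Banach
  algebra, including norm 1 = 1.  The complex scalar multiplication extends the real one.
\<close>

class unital_cstar_algebra = real_normed_algebra_1 + banach +
  fixes scaleC :: "complex \<Rightarrow> 'a \<Rightarrow> 'a" (infixr \<open>*\<^sub>C\<close> 75)
    and star :: "'a \<Rightarrow> 'a"
  assumes scaleR_scaleC: "r *\<^sub>R x = complex_of_real r *\<^sub>C x"
    and scaleC_add_right: "a *\<^sub>C (x + y) = a *\<^sub>C x + a *\<^sub>C y"
    and scaleC_add_left: "(a + b) *\<^sub>C x = a *\<^sub>C x + b *\<^sub>C x"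
    and scaleC_scaleC: "a *\<^sub>C b *\<^sub>C x = (a * b) *\<^sub>C x"
    and scaleC_one: "1 *\<^sub>C x = x"
    and mult_scaleC_left: "(a *\<^sub>C x) * y = a *\<^sub>C (x * y)"
    and mult_scaleC_right: "x * (a *\<^sub>C y) = a *\<^sub>C (x * y)"
    and norm_scaleC: "norm (a *\<^sub>C x) = cmod a * norm x"
    and star_add: "star (x + y) = star x + star y"
    and star_scaleC: "star (a *\<^sub>C x) = cnj a *\<^sub>C star x"
    and star_mult: "star (x * y) = star y * star x"
    and star_star: "star (star x) = x"
    and cstar_identity: "norm (star x * x) = (norm x)\<^sup>2"

class comm_unital_cstar_algebra = unital_cstar_algebra + comm_ring_1

definition hermitian :: "'b::unital_cstar_algebra set" where
  "hermitian = {f. f = star f}"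

text \<open>In a commutative ring, g is invertible iff it divides 1.\<close>

definition spectrum :: "'b::comm_unital_cstar_algebra \<Rightarrow> complex set" where
  "spectrum f = {z. \<not> (z *\<^sub>C 1 - f) dvd 1}"

text \<open>Multiplication by the inverse; only meaningful if the denominator is a unit.\<close>

definition quot :: "'b::comm_unital_cstar_algebra \<Rightarrow> 'b \<Rightarrow> 'b" where
  "quot f g = f * (THE h. g * h = 1)"

definition chi :: "'b::comm_unital_cstar_algebra \<Rightarrow> 'b" where
  "chi f = quot (2 * f\<^sup>2) (1 + f\<^sup>2)"

definition gam :: "'b::comm_unital_cstar_algebra \<Rightarrow> 'b" where
  "gam f = (quot (2 * f) (1 + f))\<^sup>2"


section \<open>Characters\<close>

definition characters :: "('b::comm_unital_cstar_algebra \<Rightarrow> complex) set" where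
  "characters = {x. (\<forall>f g. x (f + g) = x f + x g) \<and> (\<forall>a f. x (a *\<^sub>C f) = a * x f) \<and>
                    (\<forall>f g. x (f * g) = x f * x g) \<and> (\<exists>f. x f \<noteq> 0)}"

text \<open>The coarsest topology on the set of characters making all evaluations continuous.\<close>

definition weak_star_topology :: "('b::comm_unital_cstar_algebra \<Rightarrow> complex) topology" where
  "weak_star_topology =
     topology_generated_by {{x \<in> characters. x f \<in> U} | f U. open U}"

lemma topspace_weak_star_topology [simp]: "topspace weak_star_topology = characters"
  unfolding weak_star_topology_def by auto

text \<open>
  Here the order on \<^typ>\<open>complex\<close> is the one of \<^theory>\<open>HOL-Library.Complex_Order\<close> (equal imaginary
  parts and ordered real parts), which on real values is the usual order.
\<close>

definition character_order ::
    "'b::comm_unital_cstar_algebra set \<Rightarrow> ('b \<Rightarrow> complex) rel" where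
  "character_order C = {(x, y) \<in> characters \<times> characters. \<forall>f\<in>C. x f \<le> y f}"


section \<open>Compact ordered spaces and continuous functions on them\<close>

definition compact_ordered_space :: "'x topology \<Rightarrow> 'x rel \<Rightarrow> bool" where
  "compact_ordered_space T r \<longleftrightarrow>
     compact_space T \<and> partial_order_on (topspace T) r \<and> closedin (prod_topology T T) r"

text \<open>
  Functions on the space are represented by functions that are \<^const>\<open>undefined\<close> off the carrier, so
  that equality of functions is equality on the carrier.
\<close>

definition cfunctions :: "'x topology \<Rightarrow> ('x \<Rightarrow> complex) set" where
  "cfunctions T = {g \<in> extensional (topspace T). continuous_map T euclidean g}"

definition sup_norm :: "'x topology \<Rightarrow> ('x \<Rightarrow> complex) \<Rightarrow> real" where
  "sup_norm T g = (SUP x\<in>topspace T. cmod (g x))"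

definition isotone_on :: "'x set \<Rightarrow> 'x rel \<Rightarrow> ('x \<Rightarrow> real) \<Rightarrow> bool" where
  "isotone_on A r h \<longleftrightarrow> (\<forall>x\<in>A. \<forall>y\<in>A. (x, y) \<in> r \<longrightarrow> h x \<le> h y)"

definition pos_isotone_functions :: "'x topology \<Rightarrow> 'x rel \<Rightarrow> ('x \<Rightarrow> complex) set" where
  "pos_isotone_functions T r =
     {\<lambda>x\<in>topspace T. complex_of_real (h x) | h.
        continuous_map T euclideanreal h \<and> (\<forall>x\<in>topspace T. 0 \<le> h x) \<and>
        isotone_on (topspace T) r h}"

definition bijective_star_isometry ::
    "'x topology \<Rightarrow> ('b::unital_cstar_algebra \<Rightarrow> 'x \<Rightarrow> complex) \<Rightarrow> bool" where
  "bijective_star_isometry T \<Phi> \<longleftrightarrow>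
     bij_betw \<Phi> UNIV (cfunctions T) \<and>
     (\<forall>f g. \<forall>x\<in>topspace T. \<Phi> (f + g) x = \<Phi> f x + \<Phi> g x) \<and>
     (\<forall>a f. \<forall>x\<in>topspace T. \<Phi> (a *\<^sub>C f) x = a * \<Phi> f x) \<and>
     (\<forall>f g. \<forall>x\<in>topspace T. \<Phi> (f * g) x = \<Phi> f x * \<Phi> g x) \<and>
     (\<forall>f. \<forall>x\<in>topspace T. \<Phi> (star f) x = cnj (\<Phi> f x)) \<and>
     (\<forall>f. sup_norm T (\<Phi> f) = norm f)"

definition unit_preserving ::
    "'x topology \<Rightarrow> ('b::unital_cstar_algebra \<Rightarrow> 'x \<Rightarrow> complex) \<Rightarrow> bool" where
  "unit_preserving T \<Phi> \<longleftrightarrow> (\<forall>x\<in>topspace T. \<Phi> 1 x = 1)"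

definition gelfand ::
    "'b::comm_unital_cstar_algebra \<Rightarrow> ('b \<Rightarrow> complex) \<Rightarrow> complex" where
  "gelfand f = (\<lambda>x\<in>characters. x f)"

end

theory Submission
  imports Defs
begin

text \<open>
  Hermitian elements of norm less than 1 have the form \<open>1 - w\<^sup>2\<close>, so every preordering of the
  hermitian part (closed under sums and products and containing the squares) is archimedean.  By
  Zorn's lemma a proper preordering extends to a total one, whose Dedekind cuts define a character.
  If \<open>0 \<le> r < \<parallel>f\<parallel>\<close>, the preordering generated by \<open>f\<^sup>* f - r\<^sup>2\<close> is proper, which gives a character
  with \<open>\<bar>x f\<bar> \<ge> r\<close>; hence the Gelfand map is isometric.

  Both \<open>t \<mapsto> 2 t\<^sup>2 / (1 + t\<^sup>2)\<close> and \<open>t \<mapsto> (2 t / (1 + t))\<^sup>2\<close> are increasing on the nonnegative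
  reals, lie below the identity and have 0 and 1 as their only fixed points, so their iterates
  converge to the indicator of \<open>t \<ge> 1\<close>.  A cone stable under such a map can therefore
  almost attain indicators of increasing closed sets; by compactness, averaging (for intersections)
  and summing (for unions), it separates any two closed sets that it separates pointwise, and layer-cake
  sums of the resulting functions approximate every nonnegative continuous isotone function.
  Applied to the cone of all positive elements, the same argument shows surjectivity of the Gelfand map.
\<close>

section \<open>$C^*$-algebra basics and square roots\<close>

lemma scaleC_zero_left [simp]: "0 *\<^sub>C (x :: 'b::unital_cstar_algebra) = 0"
  using scaleR_scaleC[of 0 x] by simp

lemma scaleC_of_real: "complex_of_real r *\<^sub>C (x :: 'b::unital_cstar_algebra) = r *\<^sub>R x"
  by (simp add: scaleR_scaleC)

lemma scaleC_minus_left: "(- a) *\<^sub>C (x :: 'b::unital_cstar_algebra) = - (a *\<^sub>C x)"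
  using scaleC_add_left[of a "-a" x] by (simp add: eq_neg_iff_add_eq_0 add.commute)

lemma scaleC_minus_right: "a *\<^sub>C (- x :: 'b::unital_cstar_algebra) = - (a *\<^sub>C x)"
proof -
  have "a *\<^sub>C (0 :: 'b) = 0"
    using scaleC_scaleC[of a 0 "0::'b"] by simp
  then show ?thesis
    using scaleC_add_right[of a x "-x"] by (simp add: eq_neg_iff_add_eq_0 add.commute)
qed

lemma scaleC_diff_right: "a *\<^sub>C (x - y :: 'b::unital_cstar_algebra) = a *\<^sub>C x - a *\<^sub>C y"
  using scaleC_add_right[of a x "-y"] by (simp add: scaleC_minus_right)

lemma scaleC_i_i: "\<i> *\<^sub>C \<i> *\<^sub>C (x :: 'b::unital_cstar_algebra) = - x"
  by (simp add: scaleC_scaleC scaleC_minus_left scaleC_one)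

lemma star_zero [simp]: "star (0 :: 'b::unital_cstar_algebra) = 0"
  using star_add[of "0::'b" 0] by simp

lemma star_one [simp]: "star (1 :: 'b::unital_cstar_algebra) = 1"
  by (metis mult.right_neutral star_mult star_star)

lemma star_minus: "star (- x :: 'b::unital_cstar_algebra) = - star x"
  using star_add[of x "-x"] by (simp add: eq_neg_iff_add_eq_0 add.commute)

lemma star_diff: "star (x - y :: 'b::unital_cstar_algebra) = star x - star y"
  using star_add[of x "-y"] by (simp add: star_minus)

lemma star_scaleR: "star (r *\<^sub>R x :: 'b::unital_cstar_algebra) = r *\<^sub>R star x"
  by (simp add: scaleR_scaleC star_scaleC)

text \<open>The C*-identity and submultiplicativity give
  \<open>norm y ^ 2 <= norm (star y) * norm y\<close>; cancelling, for \<open>y = x\<close> and for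
  \<open>y = star x\<close>, yields both inequalities.\<close>

lemma norm_star [simp]: "norm (star x :: 'b::unital_cstar_algebra) = norm x"
proof -
  have le: "norm y \<le> norm (star y)" for y :: 'b
  proof (cases "y = 0")
    case False
    have "norm y * norm y \<le> norm (star y) * norm y"
      using norm_mult_ineq[of "star y" y] by (simp add: cstar_identity power2_eq_square)
    then show ?thesis
      using False by simp
  qed simp
  show ?thesis
    using le[of x] le[of "star x"] by (simp add: star_star)
qed

lemma continuous_on_star: "continuous_on A (star :: 'b::unital_cstar_algebra \<Rightarrow> 'b)"
proof -
  have "bounded_linear (star :: 'b \<Rightarrow> 'b)"
    by (rule bounded_linear_intro[where K = 1]) (simp_all add: star_add star_scaleR)
  then show ?thesis
    by (simp add: linear_continuous_on)
qed

lemma closed_hermitian: "closed (hermitian :: 'b::unital_cstar_algebra set)"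
  unfolding hermitian_def
  by (intro closed_Collect_eq continuous_on_id continuous_on_star)

lemma hermitian_star: "f \<in> hermitian \<Longrightarrow> star f = f"
  by (simp add: hermitian_def)

lemma hermitian_add: "f \<in> hermitian \<Longrightarrow> g \<in> hermitian \<Longrightarrow> f + g \<in> hermitian"
  by (simp add: hermitian_def star_add)

lemma hermitian_diff: "f \<in> hermitian \<Longrightarrow> g \<in> hermitian \<Longrightarrow> f - g \<in> hermitian"
  by (simp add: hermitian_def star_diff)

lemma hermitian_minus: "f \<in> hermitian \<Longrightarrow> - f \<in> hermitian"
  by (simp add: hermitian_def star_minus)

lemma hermitian_scaleR: "f \<in> hermitian \<Longrightarrow> r *\<^sub>R f \<in> hermitian"
  by (simp add: hermitian_def star_scaleR)

lemma hermitian_mult: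
  "f \<in> hermitian \<Longrightarrow> g \<in> hermitian \<Longrightarrow> f * g \<in> (hermitian :: 'b::comm_unital_cstar_algebra set)"
  by (simp add: hermitian_def star_mult mult.commute)

lemma hermitian_zero: "0 \<in> hermitian"
  by (simp add: hermitian_def)

lemma hermitian_one: "1 \<in> hermitian"
  by (simp add: hermitian_def)

lemma hermitian_of_real: "of_real r \<in> hermitian"
  by (simp add: of_real_def hermitian_scaleR hermitian_one)

lemmas hermitian_intros = hermitian_add hermitian_diff hermitian_minus hermitian_scaleR
  hermitian_mult hermitian_zero hermitian_one hermitian_of_real

definition re_part :: "'b::unital_cstar_algebra \<Rightarrow> 'b" where
  "re_part f = (1/2) *\<^sub>R (f + star f)"

definition im_part :: "'b::unital_cstar_algebra \<Rightarrow> 'b" where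
  "im_part f = (- \<i> / 2) *\<^sub>C (f - star f)"

lemma re_part_hermitian: "re_part f \<in> hermitian"
  by (simp add: hermitian_def re_part_def star_scaleR star_add star_star add.commute)

lemma im_part_hermitian: "im_part f \<in> hermitian"
proof -
  have "star (im_part f) = (\<i> / 2) *\<^sub>C (- (f - star f))"
    by (simp add: im_part_def star_scaleC star_diff star_star)
  also have "\<dots> = im_part f"
    by (simp add: im_part_def scaleC_minus_right scaleC_minus_left del: minus_diff_eq)
  finally show ?thesis
    by (simp add: hermitian_def)
qed

lemma i_im_part: "\<i> *\<^sub>C im_part f = (1/2) *\<^sub>R (f - star f)"
proof -
  have "\<i> *\<^sub>C im_part f = complex_of_real (1/2) *\<^sub>C (f - star f)"
    by (simp add: im_part_def scaleC_scaleC)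
  then show ?thesis
    by (simp only: scaleC_of_real)
qed

lemma re_im_decomp: "f = re_part f + \<i> *\<^sub>C im_part f"
proof -
  have "re_part f + \<i> *\<^sub>C im_part f = (1/2) *\<^sub>R (f + f)"
    by (simp add: i_im_part re_part_def flip: scaleR_add_right)
  then show ?thesis
    by (simp flip: scaleR_2)
qed

lemma re_part_unique:
  assumes "a \<in> hermitian" "b \<in> hermitian"
  shows "re_part (a + \<i> *\<^sub>C b) = a" "im_part (a + \<i> *\<^sub>C b) = b"
proof -
  have s: "star (a + \<i> *\<^sub>C b) = a - \<i> *\<^sub>C b"
    using assms by (simp add: star_add star_scaleC hermitian_star scaleC_minus_left)
  show "re_part (a + \<i> *\<^sub>C b) = a"
    by (simp add: re_part_def s flip: scaleR_2)
  have "(- \<i> / 2) *\<^sub>C (\<i> *\<^sub>C b + \<i> *\<^sub>C b) = b"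
    by (simp add: scaleC_scaleC scaleC_one flip: scaleC_add_left)
  then show "im_part (a + \<i> *\<^sub>C b) = b"
    by (simp add: im_part_def s)
qed

lemma star_mult_re_im:
  fixes f :: "'b::comm_unital_cstar_algebra"
  assumes "a \<in> hermitian" "b \<in> hermitian"
  shows "star (a + \<i> *\<^sub>C b) * (a + \<i> *\<^sub>C b) = a * a + b * (b :: 'b)"
proof -
  have s: "star (a + \<i> *\<^sub>C b) = a - \<i> *\<^sub>C b"
    using assms by (simp add: star_add star_scaleC hermitian_star scaleC_minus_left)
  have "(a - \<i> *\<^sub>C b) * (a + \<i> *\<^sub>C b) = a * a - (\<i> *\<^sub>C b) * (\<i> *\<^sub>C b)"
    by (simp add: algebra_simps)
  also have "(\<i> *\<^sub>C b) * (\<i> *\<^sub>C b) = - (b * b)"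
    by (simp only: mult_scaleC_left mult_scaleC_right scaleC_i_i)
  finally show ?thesis
    by (simp add: s)
qed

section \<open>Norm estimates, square roots and inverses\<close>

lemma norm_re_part_le: "norm (re_part f) \<le> norm f"
  using norm_triangle_ineq[of f "star f"] by (simp add: re_part_def)

text \<open>Here \<open>a\<close> is the real part of \<open>a + i b\<close>, and the C*-identity
  turns the squared norm of \<open>a + i b\<close> into the norm of \<open>a * a + b * b\<close>.
  This is how the C*-identity yields order information.\<close>

lemma norm_square_le_sum_squares:
  fixes a b :: "'b::comm_unital_cstar_algebra"
  assumes "a \<in> hermitian" "b \<in> hermitian"
  shows "norm (a * a) \<le> norm (a * a + b * b)"
proof -
  have "norm (a * a) \<le> (norm a)\<^sup>2"
    using norm_mult_ineq[of a a] by (simp add: power2_eq_square)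
  also have "\<dots> \<le> (norm (a + \<i> *\<^sub>C b))\<^sup>2"
    using norm_re_part_le[of "a + \<i> *\<^sub>C b"] re_part_unique(1)[OF assms] by (simp add: power_mono)
  also have "\<dots> = norm (a * a + b * b)"
    by (simp add: star_mult_re_im[OF assms] flip: cstar_identity)
  finally show ?thesis .
qed

text \<open>A fixed point of \<open>y |-> (u + y * y) / 2\<close> satisfies
  \<open>(1 - y)^2 = 1 - u\<close>. On the hermitian ball of radius \<open>norm u\<close> this map
  contracts with constant \<open>norm u\<close>, so Banach's theorem replaces the binomial
  series.\<close>

lemma hermitian_sqrt:
  fixes u :: "'b::comm_unital_cstar_algebra"
  assumes u: "u \<in> hermitian" and n: "norm u < 1"
  obtains w where "w \<in> hermitian" "w * w = 1 - u"
proof -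
  define q where "q = norm u"
  define S :: "'b set" where "S = hermitian \<inter> cball 0 q"
  define F where "F y = (1/2) *\<^sub>R (u + y * y)" for y
  have q: "0 \<le> q" "q < 1"
    using n by (auto simp: q_def)
  have "\<exists>!y\<in>S. F y = y"
  proof (rule Banach_fix)
    show "complete S"
      unfolding complete_eq_closed S_def by (intro closed_Int closed_hermitian closed_cball)
    show "S \<noteq> {}"
      using q by (auto simp: S_def intro!: exI[of _ 0] hermitian_zero)
    show "0 \<le> q" "q < 1"
      by fact+
    show "F ` S \<subseteq> S"
    proof safe
      fix y assume "y \<in> S"
      then have y: "y \<in> hermitian" "norm y \<le> q"
        by (auto simp: S_def)
      have "norm (u + y * y) \<le> norm u + norm y * norm y"
        by (meson add_left_mono norm_mult_ineq norm_triangle_le)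
      also have "\<dots> \<le> q + q * q"
        using y q by (intro add_mono mult_mono) (auto simp: q_def)
      also have "\<dots> \<le> 2 * q"
        using q mult_left_mono[of q 1 q] by simp
      finally show "F y \<in> S"
        using y u by (auto simp: S_def F_def intro!: hermitian_intros)
    qed
    fix y z assume yz: "y \<in> S" "z \<in> S"
    have "dist (F y) (F z) = norm ((1/2) *\<^sub>R ((y - z) * (y + z)))"
      by (simp add: F_def dist_norm algebra_simps)
    also have "\<dots> \<le> (1/2) * (norm (y - z) * norm (y + z))"
      by (simp add: norm_mult_ineq)
    also have "\<dots> \<le> (1/2) * (norm (y - z) * (2 * q))"
      using yz norm_triangle_ineq[of y z]
      by (intro mult_left_mono) (auto simp: S_def)
    finally show "dist (F y) (F z) \<le> q * dist y z"
      by (simp add: dist_norm mult.commute)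
  qed
  then obtain y where y: "y \<in> S" "F y = y"
    by blast
  have "2 *\<^sub>R F y = u + y * y"
    by (simp add: F_def)
  then have "u + y * y = y + y"
    using y by (simp add: scaleR_2)
  then have "(1 - y) * (1 - y) = 1 - u"
    by (simp add: algebra_simps)
  moreover have "1 - y \<in> hermitian"
    using y by (auto simp: S_def intro!: hermitian_intros)
  ultimately show thesis
    using that by blast
qed

text \<open>The map \<open>y |-> 1 + u * y\<close> contracts with constant \<open>norm u\<close>;
  its fixed point is the inverse, in place of the Neumann series.\<close>

lemma one_minus_dvd_one:
  fixes u :: "'b::comm_unital_cstar_algebra"
  assumes "norm u < 1"
  shows "(1 - u) dvd 1"
proof -
  have "\<exists>!y. 1 + u * y = y"
  proof (rule banach_fix_type)
    show "\<forall>y z. dist (1 + u * y) (1 + u * z) \<le> norm u * dist y z"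
      using norm_mult_ineq[of u] by (simp add: dist_norm flip: right_diff_distrib)
  qed (use assms in auto)
  then obtain y where "1 + u * y = y"
    by blast
  then have "1 = (1 - u) * y"
    by (simp add: left_diff_distrib eq_diff_eq)
  then show ?thesis
    by (rule dvdI)
qed

section \<open>Sums of squares and preorderings\<close>

text \<open>The least preordering; \<open>0\<close> belongs to it as \<open>0 * 0\<close>.\<close>

inductive_set sos :: "'b::comm_unital_cstar_algebra set" where
  square: "f \<in> hermitian \<Longrightarrow> f * f \<in> sos"
| add: "f \<in> sos \<Longrightarrow> g \<in> sos \<Longrightarrow> f + g \<in> sos"

text \<open>Properness is a separate condition, that \<open>- 1\<close> is not in \<open>T\<close>,
  so that an extension can be formed before it is known to be proper.\<close>

definition preordering :: "'b::comm_unital_cstar_algebra set \<Rightarrow> bool" where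
  "preordering T \<longleftrightarrow> T \<subseteq> hermitian \<and> (\<forall>f\<in>hermitian. f * f \<in> T) \<and>
     (\<forall>f\<in>T. \<forall>g\<in>T. f + g \<in> T \<and> f * g \<in> T)"

context
  fixes T :: "'b::comm_unital_cstar_algebra set"
  assumes T: "preordering T"
begin

lemma preordering_hermitian: "f \<in> T \<Longrightarrow> f \<in> hermitian"
  and preordering_square: "f \<in> hermitian \<Longrightarrow> f * f \<in> T"
  and preordering_add: "f \<in> T \<Longrightarrow> g \<in> T \<Longrightarrow> f + g \<in> T"
  and preordering_mult: "f \<in> T \<Longrightarrow> g \<in> T \<Longrightarrow> f * g \<in> T"
  using T unfolding preordering_def by blast+

lemma preordering_of_real:
  assumes "0 \<le> c"
  shows "of_real c \<in> T"
proof -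
  have "of_real (sqrt c) * of_real (sqrt c) \<in> T"
    by (intro preordering_square hermitian_of_real)
  then show ?thesis
    using assms by (simp flip: of_real_mult)
qed

lemma preordering_scaleR: "0 \<le> c \<Longrightarrow> f \<in> T \<Longrightarrow> c *\<^sub>R f \<in> T"
  using preordering_mult[OF preordering_of_real, of c f] by (simp add: scaleR_conv_of_real)

lemma preordering_zero: "0 \<in> T"
  using preordering_of_real[of 0] by simp

lemma preordering_one: "1 \<in> T"
  using preordering_of_real[of 1] by simp

text \<open>Archimedean property: \<open>h / r\<close> has norm less than 1, so
  \<open>1 - h / r\<close> is a square; scaling by \<open>r > 0\<close> stays in the
  preordering.\<close>

lemma preordering_norm_less:
  assumes "h \<in> hermitian" "norm h < r"
  shows "of_real r - h \<in> T"
proof -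
  have r: "0 < r"
    using assms(2) norm_ge_zero[of h] by linarith
  obtain w where w: "w \<in> hermitian" "w * w = 1 - (1/r) *\<^sub>R h"
    by (rule hermitian_sqrt[of "(1/r) *\<^sub>R h"]) (use assms r in \<open>auto intro: hermitian_scaleR\<close>)
  have "r *\<^sub>R (w * w) \<in> T"
    using r w by (intro preordering_scaleR preordering_square) auto
  also have "r *\<^sub>R (w * w) = of_real r - h"
    using r by (simp add: w(2) scaleR_diff_right of_real_def)
  finally show ?thesis .
qed

lemma preordering_proper_iff:
  assumes "- 1 \<notin> T"
  shows "of_real r \<in> T \<longleftrightarrow> 0 \<le> r"
proof
  assume r: "of_real r \<in> T"
  show "0 \<le> r"
  proof (rule ccontr)
    assume "\<not> 0 \<le> r"
    then have "(1 / - r) *\<^sub>R of_real r \<in> T"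
      using r by (intro preordering_scaleR) auto
    moreover have "(1 / - r) *\<^sub>R of_real r = (- 1 :: 'b)"
      using \<open>\<not> 0 \<le> r\<close> by (simp add: of_real_def)
    ultimately show False
      using assms by simp
  qed
qed (rule preordering_of_real)

text \<open>Terms linear in \<open>g\<close> suffice: in a product the factor \<open>g * g\<close>
  is a square and is absorbed into the part from \<open>T\<close>.\<close>

lemma preordering_extend:
  assumes g: "g \<in> hermitian"
  shows "preordering {s + g * t | s t. s \<in> T \<and> t \<in> T}" (is "preordering ?E")
  unfolding preordering_def
proof (intro conjI ballI subsetI)
  fix f assume "f \<in> ?E"
  then show "f \<in> hermitian"
    using g by (auto intro!: hermitian_intros dest: preordering_hermitian)
next
  fix f :: 'b assume f: "f \<in> hermitian"
  have "f * f = f * f + g * 0"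
    by simp
  then show "f * f \<in> ?E"
    using preordering_square[OF f] preordering_zero by blast
next
  fix f h assume "f \<in> ?E" "h \<in> ?E"
  then obtain s t s' t' where st: "s \<in> T" "t \<in> T" "s' \<in> T" "t' \<in> T"
    and [simp]: "f = s + g * t" "h = s' + g * t'"
    by blast
  have "f + h = (s + s') + g * (t + t')"
    by (simp add: algebra_simps)
  then show "f + h \<in> ?E"
    using st by (blast intro: preordering_add)
  have "f * h = (s * s' + (g * g) * (t * t')) + g * (s * t' + s' * t)"
    by (simp add: algebra_simps)
  moreover have "s * s' + (g * g) * (t * t') \<in> T" "s * t' + s' * t \<in> T"
    using st g by (auto intro!: preordering_add preordering_mult preordering_square)
  ultimately show "f * h \<in> ?E"
    by blast
qed

lemma preordering_subset_extend: "T \<subseteq> {s + g * t | s t. s \<in> T \<and> t \<in> T}"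
proof
  fix f assume f: "f \<in> T"
  have "f = f + g * 0"
    by simp
  then show "f \<in> {s + g * t | s t. s \<in> T \<and> t \<in> T}"
    using f preordering_zero by blast
qed

lemma preordering_mem_extend: "g \<in> {s + g * t | s t. s \<in> T \<and> t \<in> T}"
proof -
  have "g = 0 + g * 1"
    by simp
  then show ?thesis
    using preordering_zero preordering_one by blast
qed

text \<open>If \<open>p t = 1 + s\<close> with \<open>s, t\<close> in the preordering, then a bound \<open>p + r \<in> T\<close> can be improved by
  a fixed amount as long as \<open>r \<ge> 0\<close>.\<close>
lemma preordering_positivstellensatz:
  assumes p: "p \<in> hermitian" and s: "s \<in> T" and t: "t \<in> T" and eq: "p * t = 1 + s"
  shows "p \<in> T"
proof -
  define k where "k = norm t + 1"
  have k: "0 < k" "norm t < k"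
    unfolding k_def using norm_ge_zero[of t] by linarith+
  have kt: "of_real k - t \<in> T" "of_real (2 * k) - t \<in> T"
    using k by (simp_all only: preordering_norm_less preordering_hermitian[OF t])
  have improve: "p + of_real (r - 1 / k) \<in> T" if r: "0 \<le> r" and pr: "p + of_real r \<in> T" for r
  proof -
    define g where "g = p + of_real r"
    have g: "g \<in> T"
      using pr by (simp add: g_def)
    \<comment> \<open>Since \<open>(k - t)^2 = k^2 - t (2 k - t)\<close>, the other terms with
      \<open>r\<close> cancel, and \<open>p t = 1 + s\<close> leaves \<open>k^2 (p + r) - k\<close>.
      Dividing by \<open>k^2\<close> gains \<open>1 / k\<close>.\<close>
    have "(of_real k - t) * (of_real k - t) * g + (of_real (2 * k) - t) * s + (of_real k - t)
        + of_real r * t * (of_real (2 * k) - t) \<in> T"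
      using kt g s t r by (intro preordering_add preordering_mult preordering_of_real) auto
    also have "(of_real k - t) * (of_real k - t) * g + (of_real (2 * k) - t) * s + (of_real k - t)
        + of_real r * t * (of_real (2 * k) - t)
      = of_real k * of_real k * (p + of_real r) + (of_real (2 * k) - t) * (1 + s - p * t) - of_real k"
      by (simp add: g_def algebra_simps)
    also have "\<dots> = of_real (k * k) * (p + of_real r) - of_real k"
      by (simp add: eq)
    finally have "(1 / (k * k)) *\<^sub>R (of_real (k * k) * (p + of_real r) - of_real k) \<in> T"
      using k by (intro preordering_scaleR) auto
    also have "(1 / (k * k)) *\<^sub>R (of_real (k * k) * (p + of_real r) - of_real k) = p + of_real (r - 1 / k)"
      using k by (simp add: scaleR_conv_of_real right_diff_distrib flip: mult.assoc of_real_mult)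
    finally show ?thesis .
  qed
  \<comment> \<open>Starting from the shift \<open>norm p + 1\<close>, each round lowers it by
    \<open>1 / k\<close>. A negative shift would already put \<open>p\<close> into \<open>T\<close>,
    so the condition \<open>0 <= r\<close> of \<open>improve\<close> holds as long as
    \<open>p\<close> is outside \<open>T\<close>.\<close>
  have "p + of_real (norm p + 1 - n / k) \<in> T \<or> p \<in> T" for n :: nat
  proof (induction n)
    case 0
    have "of_real (norm p + 1) - (- p) \<in> T"
      using p by (intro preordering_norm_less hermitian_minus) auto
    then show ?case
      by (simp add: add.commute)
  next
    case (Suc n)
    define r where "r = norm p + 1 - n / k"
    show ?case
    proof (cases "p \<in> T")
      case False
      then have pr: "p + of_real r \<in> T"
        using Suc by (simp add: r_def)
      have "0 \<le> r"
      proof (rule ccontr)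
        assume "\<not> 0 \<le> r"
        then have "(p + of_real r) + of_real (- r) \<in> T"
          by (intro preordering_add[OF pr] preordering_of_real) auto
        then show False
          using False by simp
      qed
      then have "p + of_real (r - 1 / k) \<in> T"
        using pr by (rule improve)
      also have "r - 1 / k = norm p + 1 - Suc n / k"
        by (simp add: r_def add_divide_distrib)
      finally show ?thesis by simp
    qed simp
  qed
  moreover obtain n :: nat where n: "(norm p + 1) * k \<le> n"
    using real_arch_simple by blast
  ultimately consider "p + of_real (norm p + 1 - n / k) \<in> T" | "p \<in> T"
    by blast
  then show ?thesis
  proof cases
    case 1
    have "norm p + 1 \<le> n / k"
      using n k by (simp add: field_simps)
    then have "(p + of_real (norm p + 1 - n / k)) + of_real (n / k - (norm p + 1)) \<in> T"
      by (intro preordering_add[OF 1] preordering_of_real) auto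
    then show ?thesis
      by (simp add: algebra_simps flip: of_real_add of_real_diff)
  qed
qed

end

text \<open>Products of sums of squares expand into products of two squares, and
  \<open>a^2 b^2 = (a b)^2\<close> by commutativity. The fact \<open>*\<close> treats one square
  against an arbitrary sum.\<close>

lemma preordering_sos: "preordering (sos :: 'b::comm_unital_cstar_algebra set)"
  unfolding preordering_def
proof (intro conjI ballI subsetI)
  fix f g :: 'b
  assume f: "f \<in> sos" and g: "g \<in> sos"
  show "f + g \<in> sos"
    using f g by (rule sos.add)
  have *: "a * a * g \<in> sos" if a: "a \<in> hermitian" for a
    using g
  proof induction
    case (square b)
    have "(a * b) * (a * b) \<in> sos"
      using a square by (intro sos.square hermitian_mult)
    then show ?case
      by (simp add: ac_simps)
  qed (simp add: distrib_left sos.add)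
  show "f * g \<in> sos"
    using f by induction (simp_all add: * distrib_right sos.add)
next
  fix f :: 'b assume "f \<in> sos"
  then show "f \<in> hermitian"
    by induction (auto intro: hermitian_intros)
qed (rule sos.square)

section \<open>Norm bounds for sums of squares\<close>

lemma norm_one_minus_square_le:
  fixes a :: "'b::comm_unital_cstar_algebra"
  assumes a: "a \<in> hermitian" and n: "norm a < 1"
  shows "norm (1 - a * a) \<le> 1"
proof -
  have "norm (a * a) < 1"
    using norm_mult_ineq[of a a] n mult_strict_mono[of "norm a" 1 "norm a" 1] by force
  then obtain w where w: "w \<in> hermitian" "w * w = 1 - a * a"
    using hermitian_sqrt[of "a * a"] a by (auto intro: hermitian_mult)
  \<comment> \<open>Adding the square \<open>a * a\<close> to \<open>w * w\<close> gives 1, whose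
    norm therefore bounds that of \<open>w * w\<close>.\<close>
  have "norm (w * w) \<le> norm (w * w + a * a)"
    by (rule norm_square_le_sum_squares[OF w(1) a])
  then show ?thesis
    by (simp add: w(2))
qed

text \<open>The norm condition encodes that the spectrum of \<open>f\<close> lies in
  \<open>[0, 2 s]\<close>, and the triangle inequality passes it on to sums. For one square,
  rescaling by \<open>norm f + 1\<close> reduces to the preceding lemma.\<close>

lemma sos_norm_diff_le:
  assumes "f \<in> sos"
  obtains s where "0 \<le> s" "norm (of_real s - f) \<le> s"
proof -
  have "\<exists>s\<ge>0. norm (of_real s - f) \<le> s"
    using assms
  proof induction
    case (square f)
    define c where "c = norm f + 1"
    have c: "0 < c" "norm f < c"
      unfolding c_def using norm_ge_zero[of f] by linarith+
    have "norm (1 - ((1/c) *\<^sub>R f) * ((1/c) *\<^sub>R f)) \<le> 1"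
      using square c by (intro norm_one_minus_square_le hermitian_scaleR) auto
    then have "(c * c) * norm (1 - ((1/c) *\<^sub>R f) * ((1/c) *\<^sub>R f)) \<le> (c * c) * 1"
      using c by (intro mult_left_mono) auto
    also have "(c * c) * norm (1 - ((1/c) *\<^sub>R f) * ((1/c) *\<^sub>R f))
        = norm ((c * c) *\<^sub>R (1 - ((1/c) *\<^sub>R f) * ((1/c) *\<^sub>R f)))"
      using c by simp
    also have "(c * c) *\<^sub>R (1 - ((1/c) *\<^sub>R f) * ((1/c) *\<^sub>R f)) = of_real (c * c) - f * f"
      using c by (simp add: scaleR_diff_right of_real_def)
    finally show ?case
      using c by (intro exI[of _ "c * c"]) auto
  next
    case (add f g)
    then obtain s t where st: "0 \<le> s" "0 \<le> t" "norm (of_real s - f) \<le> s" "norm (of_real t - g) \<le> t"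
      by blast
    have "norm ((of_real s - f) + (of_real t - g)) \<le> s + t"
      using st by (intro norm_triangle_le) auto
    then show ?case
      using st by (intro exI[of _ "s + t"]) (auto simp: algebra_simps)
  qed
  then show thesis
    using that by blast
qed

text \<open>With \<open>r = s + d\<close>, the element \<open>f + d\<close> is
  \<open>r (1 - u)\<close> where \<open>norm u <= s / r < 1\<close>, so
  \<open>hermitian_sqrt\<close> applies. Up to a small shift every sum of squares is a single
  square.\<close>

lemma sos_add_of_real_square:
  fixes f :: "'b::comm_unital_cstar_algebra"
  assumes f: "f \<in> sos" and d: "0 < d"
  obtains w where "w \<in> hermitian" "w * w = f + of_real d"
proof -
  obtain s where s: "0 \<le> s" "norm (of_real s - f) \<le> s"
    by (rule sos_norm_diff_le[OF f])
  define r where "r = s + d"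
  have r: "0 < r" "s < r"
    using s d by (auto simp: r_def)
  define u where "u = (1/r) *\<^sub>R (of_real s - f)"
  have "f \<in> hermitian"
    using preordering_hermitian[OF preordering_sos] f .
  then have u: "u \<in> hermitian"
    by (auto simp: u_def intro!: hermitian_intros)
  have un: "norm u < 1"
    using s r by (simp add: u_def)
  obtain w where w: "w \<in> hermitian" "w * w = 1 - u"
    by (rule hermitian_sqrt[OF u un])
  have "(sqrt r *\<^sub>R w) * (sqrt r *\<^sub>R w) = r *\<^sub>R (1 - u)"
    using r by (simp add: w(2) flip: scaleR_scaleR) (simp add: w(2))
  also have "\<dots> = of_real r - (of_real s - f)"
    using r by (simp add: u_def scaleR_diff_right of_real_def)
  also have "\<dots> = f + of_real d"
    by (simp add: r_def)
  finally show thesis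
    using that w by (meson hermitian_scaleR)
qed

text \<open>Shifted by \<open>d\<close>, both \<open>a\<close> and \<open>r - a\<close> become
  single squares with sum \<open>r + 2 d\<close>, so \<open>norm (a + d) <= r + 2 d\<close>.
  Removing the shift costs another \<open>d\<close>, and \<open>d\<close> is arbitrary.\<close>

lemma norm_le_of_sos:
  fixes a :: "'b::comm_unital_cstar_algebra"
  assumes r: "0 \<le> r" and a: "a \<in> sos" and ra: "of_real r - a \<in> sos"
  shows "norm a \<le> r"
proof -
  have bound: "norm a \<le> r + 3 * d" if d: "0 < d" for d
  proof -
    obtain w where w: "w \<in> hermitian" "w * w = a + of_real d"
      by (rule sos_add_of_real_square[OF a d])
    obtain v where v: "v \<in> hermitian" "v * v = of_real r - a + of_real d"
      by (rule sos_add_of_real_square[OF ra d])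
    have "norm (a + of_real d) \<le> norm (of_real (r + 2 * d) :: 'b)"
      using norm_square_le_sum_squares[OF w(1) v(1)] by (simp add: w v algebra_simps)
    moreover have "norm a \<le> norm (a + of_real d) + norm (of_real d :: 'b)"
      using norm_triangle_ineq4[of "a + of_real d" "of_real d"] by simp
    moreover have "norm (of_real (r + 2 * d) :: 'b) = r + 2 * d"
      using r d by (simp only: norm_of_real)
    ultimately show ?thesis
      using d r by simp
  qed
  show ?thesis
  proof (rule field_le_epsilon)
    fix e :: real assume "0 < e"
    then show "norm a \<le> r + e"
      using bound[of "e / 3"] by simp
  qed
qed

section \<open>Characters from total preorderings\<close>

lemma preordering_Union_chain:
  assumes "\<C> \<noteq> {}" "subset.chain {T. preordering T} \<C>"
  shows "preordering (\<Union>\<C>)"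
  unfolding preordering_def
proof (intro conjI ballI)
  have pre: "preordering T" if "T \<in> \<C>" for T
    using assms that by (auto simp: subset_chain_def)
  show "\<Union>\<C> \<subseteq> hermitian"
    using preordering_hermitian[OF pre] by blast
  show "f * f \<in> \<Union>\<C>" if "f \<in> hermitian" for f
    using assms(1) preordering_square[OF pre that] by blast
  fix f g assume "f \<in> \<Union>\<C>" "g \<in> \<Union>\<C>"
  then obtain T T' where T: "T \<in> \<C>" "T' \<in> \<C>" "f \<in> T" "g \<in> T'"
    by blast
  then have "T \<subseteq> T' \<or> T' \<subseteq> T"
    using assms(2) by (auto simp: subset_chain_def)
  then obtain T where "T \<in> \<C>" "f \<in> T" "g \<in> T"
    using T by blast
  then show "f + g \<in> \<Union>\<C>" "f * g \<in> \<Union>\<C>"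
    using preordering_add[OF pre] preordering_mult[OF pre] by blast+
qed

text \<open>In a maximal proper preordering, adjoining any hermitian element from outside produces
  \<open>- 1\<close>; this cannot happen for both \<open>f\<close> and \<open>- f\<close>.\<close>

lemma total_preordering_exists:
  fixes T0 :: "'b::comm_unital_cstar_algebra set"
  assumes T0: "preordering T0" "- 1 \<notin> T0"
  obtains T where "T0 \<subseteq> T" "preordering T" "- 1 \<notin> T" "\<And>f. f \<in> hermitian \<Longrightarrow> f \<in> T \<or> - f \<in> T"
proof -
  define \<A> where "\<A> = {T. preordering T \<and> - 1 \<notin> T \<and> T0 \<subseteq> T}"
  have "\<exists>M\<in>\<A>. \<forall>X\<in>\<A>. M \<subseteq> X \<longrightarrow> X = M"
  proof (rule subset_Zorn_nonempty)
    show "\<A> \<noteq> {}"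
      using T0 by (auto simp: \<A>_def)
    fix \<C> assume C: "\<C> \<noteq> {}" "subset.chain \<A> \<C>"
    then have "subset.chain {T. preordering T} \<C>"
      by (auto simp: subset_chain_def \<A>_def)
    then have "preordering (\<Union>\<C>)"
      by (rule preordering_Union_chain[OF C(1)])
    then show "\<Union>\<C> \<in> \<A>"
      using C by (auto simp: \<A>_def subset_chain_def)
  qed
  then obtain T where TA: "T \<in> \<A>" and TM: "\<And>X. X \<in> \<A> \<Longrightarrow> T \<subseteq> X \<Longrightarrow> X = T"
    by blast
  have T: "preordering T" "- 1 \<notin> T" "T0 \<subseteq> T"
    using TA by (auto simp: \<A>_def)
  have max: "X = T" if "preordering X" "- 1 \<notin> X" "T \<subseteq> X" for X
    using that T by (intro TM) (auto simp: \<A>_def)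
  have ext: "\<exists>s\<in>T. \<exists>t\<in>T. - 1 = s + g * t" if "g \<in> hermitian" "g \<notin> T" for g
  proof -
    have "- 1 \<in> {s + g * t | s t. s \<in> T \<and> t \<in> T}"
    proof (rule ccontr)
      assume "\<not> ?thesis"
      then have "{s + g * t | s t. s \<in> T \<and> t \<in> T} = T"
        by (rule max[OF preordering_extend[OF T(1) that(1)] _ preordering_subset_extend[OF T(1)]])
      then show False
        using preordering_mem_extend[OF T(1), of g] that(2) by simp
    qed
    then show ?thesis by blast
  qed
  have "f \<in> T \<or> - f \<in> T" if f: "f \<in> hermitian" for f
  proof (rule ccontr)
    assume "\<not> (f \<in> T \<or> - f \<in> T)"
    then obtain s t s' t' where st: "s \<in> T" "t \<in> T" "s' \<in> T" "t' \<in> T"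
      and eq: "- 1 = s + f * t" "- 1 = s' + (- f) * t'"
      using ext[OF f] ext[OF hermitian_minus[OF f]] by blast
    have "f * t = (s + f * t) - s"
      by simp
    then have e: "f * t = - (1 + s)"
      by (simp only: eq(1)[symmetric]) simp
    have "f * t' = s' - (s' + (- f) * t')"
      by simp
    then have e': "f * t' = 1 + s'"
      by (simp only: eq(2)[symmetric]) simp
    \<comment> \<open>The product of \<open>f t = - (1 + s)\<close> and \<open>f t' = 1 + s'\<close>
      is \<open>f^2 t t' = - (1 + s) (1 + s')\<close>, which rearranges to a representation of
      \<open>- 1\<close> by elements of \<open>T\<close>.\<close>
    have "s + s' + s * s' + (f * f) * (t * t') \<in> T"
      using st f T(1) by (intro preordering_add preordering_mult preordering_square)
    moreover have "(f * f) * (t * t') = (f * t) * (f * t')"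
      by (simp add: ac_simps)
    then have "s + s' + s * s' + (f * f) * (t * t') = - 1"
      by (simp add: e e' algebra_simps)
    ultimately show False
      using T(2) by simp
  qed
  then show thesis
    using that T by blast
qed

text \<open>Reading membership of \<open>of_real r - h\<close> in \<open>T\<close> as
  \<open>h <= r\<close>, the set is the upper half of a Dedekind cut. It is nonempty and bounded
  below when \<open>h\<close> is hermitian and \<open>T\<close> is a proper preordering.\<close>

definition cut :: "'b::comm_unital_cstar_algebra set \<Rightarrow> 'b \<Rightarrow> real" where
  "cut T h = Inf {r. of_real r - h \<in> T}"

definition cut_character :: "'b::comm_unital_cstar_algebra set \<Rightarrow> 'b \<Rightarrow> complex" where
  "cut_character T f = Complex (cut T (re_part f)) (cut T (im_part f))"

context
  fixes T :: "'b::comm_unital_cstar_algebra set"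
  assumes T: "preordering T" and proper: "- 1 \<notin> T"
    and total: "\<And>f. f \<in> hermitian \<Longrightarrow> f \<in> T \<or> - f \<in> T"
begin

lemma upper_lower_le:
  assumes "of_real r - h \<in> T" "h - of_real s \<in> T"
  shows "s \<le> r"
proof -
  have "(of_real r - h) + (h - of_real s) \<in> T"
    using assms by (intro preordering_add[OF T])
  then show ?thesis
    using preordering_proper_iff[OF T proper, of "r - s"] by simp
qed

lemma lower_exists: "h \<in> hermitian \<Longrightarrow> of_real (norm h + 1) + h \<in> T"
  using preordering_norm_less[OF T, of "- h" "norm h + 1"] by (simp add: hermitian_minus)

lemma upper_exists: "h \<in> hermitian \<Longrightarrow> of_real (norm h + 1) - h \<in> T"
  by (rule preordering_norm_less[OF T]) auto

lemma cut_le: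
  assumes "h \<in> hermitian" "of_real r - h \<in> T"
  shows "cut T h \<le> r"
  unfolding cut_def
proof (rule cInf_lower)
  show "bdd_below {r. of_real r - h \<in> T}"
  proof (rule bdd_belowI)
    fix r assume r: "r \<in> {r. of_real r - h \<in> T}"
    have "h - of_real (- (norm h + 1)) = of_real (norm h + 1) + h"
      by simp
    then show "- (norm h + 1) \<le> r"
      using r lower_exists[OF assms(1)] upper_lower_le by (metis mem_Collect_eq)
  qed
qed (use assms in auto)

lemma cut_ge:
  assumes "h \<in> hermitian" "h - of_real r \<in> T"
  shows "r \<le> cut T h"
  unfolding cut_def
proof (rule cInf_greatest)
  show "{r. of_real r - h \<in> T} \<noteq> {}"
    using upper_exists[OF assms(1)] by blast
qed (use upper_lower_le assms in auto)

text \<open>Totality enters here: a real number that is not an upper bound of \<open>h\<close> must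
  be a lower bound.\<close>

lemma lower_if_less_cut:
  assumes "h \<in> hermitian" "r < cut T h"
  shows "h - of_real r \<in> T"
  using total[of "of_real r - h"] cut_le[OF assms(1), of r] assms by (auto intro: hermitian_intros)

lemma upper_if_cut_less:
  assumes "h \<in> hermitian" "cut T h < r"
  shows "of_real r - h \<in> T"
  using total[of "h - of_real r"] cut_ge[OF assms(1), of r] assms by (auto intro: hermitian_intros)

lemma cut_eqI:
  assumes "h \<in> hermitian" "\<And>e. 0 < e \<Longrightarrow> of_real (v + e) - h \<in> T"
    "\<And>e. 0 < e \<Longrightarrow> h - of_real (v - e) \<in> T"
  shows "cut T h = v"
proof (rule antisym; rule field_le_epsilon)
  fix e :: real assume "0 < e"
  then show "cut T h \<le> v + e" "v \<le> cut T h + e"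
    using cut_le[OF assms(1) assms(2)[of e]] cut_ge[OF assms(1) assms(3)[of e]] by auto
qed

lemma cut_of_real: "cut T (of_real r) = r"
proof (rule cut_eqI)
  fix e :: real assume "0 < e"
  then have "of_real e \<in> T"
    by (intro preordering_of_real[OF T]) auto
  then show "of_real (r + e) - of_real r \<in> T" "of_real r - of_real (r - e) \<in> T"
    by simp_all
qed (rule hermitian_of_real)

lemma cut_add:
  assumes h: "h \<in> hermitian" and k: "k \<in> hermitian"
  shows "cut T (h + k) = cut T h + cut T k"
proof (rule cut_eqI)
  fix e :: real assume "0 < e"
  define d where "d = e / 2"
  have d: "e = d + d" "0 < d"
    using \<open>0 < e\<close> by (simp_all add: d_def)
  have "(of_real (cut T h + d) - h) + (of_real (cut T k + d) - k) \<in> T"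
    using d h k by (intro preordering_add[OF T] upper_if_cut_less) auto
  then show "of_real (cut T h + cut T k + e) - (h + k) \<in> T"
    by (simp add: d(1) algebra_simps)
  have "(h - of_real (cut T h - d)) + (k - of_real (cut T k - d)) \<in> T"
    using d h k by (intro preordering_add[OF T] lower_if_less_cut) auto
  then show "(h + k) - of_real (cut T h + cut T k - e) \<in> T"
    by (simp add: d(1) algebra_simps)
qed (intro hermitian_add h k)

lemma cut_diff:
  assumes h: "h \<in> hermitian" and k: "k \<in> hermitian"
  shows "cut T (h - k) = cut T h - cut T k"
  using cut_add[of "h - k" k] assms by (simp add: hermitian_diff)

text \<open>From \<open>- e \<le> a \<le> e\<close> and \<open>- n \<le> b \<le> n\<close> it follows that \<open>a b \<le> 3 e n\<close>, since
  \<open>3 e n - a b = (e - a) (n + b) + e (n - b) + n (e + a)\<close>.\<close>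
lemma cut_mult_zero:
  assumes a: "a \<in> hermitian" "cut T a = 0" and b: "b \<in> hermitian"
  shows "cut T (a * b) = 0"
proof -
  define n where "n = norm b + 1"
  have n: "0 < n"
    unfolding n_def using norm_ge_zero[of b] by linarith
  have bn: "of_real n - b \<in> T" "of_real n + b \<in> T"
    using lower_exists[OF b] upper_exists[OF b] by (simp_all only: n_def)
  have bound: "of_real (3 * e * n) - c * b \<in> T"
    if c: "c \<in> hermitian" "cut T c = 0" and e: "0 < e" for c e
  proof -
    have ce: "of_real e - c \<in> T" "of_real e + c \<in> T"
      using upper_if_cut_less[of c e] lower_if_less_cut[of c "- e"] c e by (simp_all add: ac_simps)
    have "(of_real e - c) * (of_real n + b) + of_real e * (of_real n - b) + of_real n * (of_real e + c) \<in> T"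
      using e n by (intro preordering_add[OF T _ preordering_mult[OF T _ ce(2)]]
          preordering_add[OF T preordering_mult[OF T ce(1) bn(2)] preordering_mult[OF T _ bn(1)]]
          preordering_of_real[OF T]) auto
    also have "(of_real e - c) * (of_real n + b) + of_real e * (of_real n - b) + of_real n * (of_real e + c)
        = of_real (3 * e * n) - c * b"
      by (simp add: algebra_simps)
    finally show ?thesis .
  qed
  \<comment> \<open>The lower bound for \<open>a * b\<close> is the upper bound for
    \<open>(- a) * b\<close>, so \<open>bound\<close> is also applied to \<open>- a\<close>.\<close>
  have m: "- a \<in> hermitian" "cut T (- a) = 0"
    using a cut_diff[of 0 a] cut_of_real[of 0] by (auto simp: hermitian_intros)
  show ?thesis
  proof (rule cut_eqI)
    show "a * b \<in> hermitian"
      using a b by (intro hermitian_mult)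
    fix e :: real assume e: "0 < e"
    have "3 * (e / (3 * n)) * n = e" "0 < e / (3 * n)"
      using e n by auto
    then show "of_real (0 + e) - a * b \<in> T" "a * b - of_real (0 - e) \<in> T"
      using bound[OF a, of "e / (3 * n)"] bound[OF m, of "e / (3 * n)"] by (simp_all add: ac_simps)
  qed
qed

text \<open>Subtracting its cut value from \<open>b\<close> leaves an element \<open>k\<close> of
  cut 0, and \<open>cut_mult_zero\<close> preserves this under multiplication. No case split on the
  sign of \<open>c\<close> arises.\<close>

lemma cut_mult_of_real:
  assumes b: "b \<in> hermitian"
  shows "cut T (of_real c * b) = c * cut T b"
proof -
  define k where "k = b - of_real (cut T b)"
  have k: "k \<in> hermitian" "cut T k = 0"
    using b by (auto simp: k_def cut_diff cut_of_real hermitian_intros)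
  have "of_real c * b = k * of_real c + of_real (c * cut T b)"
    by (simp add: k_def algebra_simps)
  then have "cut T (of_real c * b) = cut T (k * of_real c + of_real (c * cut T b))"
    by (rule arg_cong)
  also have "\<dots> = c * cut T b"
    by (simp only: cut_add[OF hermitian_mult[OF k(1) hermitian_of_real] hermitian_of_real]
        cut_mult_zero[OF k hermitian_of_real] cut_of_real)
  finally show ?thesis .
qed

lemma cut_scaleR: "b \<in> hermitian \<Longrightarrow> cut T (c *\<^sub>R b) = c * cut T b"
  using cut_mult_of_real by (simp add: scaleR_conv_of_real)

lemma cut_mult:
  assumes a: "a \<in> hermitian" and b: "b \<in> hermitian"
  shows "cut T (a * b) = cut T a * cut T b"
proof -
  define k where "k = a - of_real (cut T a)"
  have k: "k \<in> hermitian" "cut T k = 0"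
    using a by (auto simp: k_def cut_diff cut_of_real hermitian_intros)
  have "a * b = k * b + of_real (cut T a) * b"
    by (simp add: k_def algebra_simps)
  then have "cut T (a * b) = cut T (k * b + of_real (cut T a) * b)"
    by (rule arg_cong)
  also have "\<dots> = cut T a * cut T b"
    using k b by (simp add: cut_add cut_mult_zero cut_mult_of_real hermitian_intros)
  finally show ?thesis .
qed

lemma cut_character_re_im:
  assumes "a \<in> hermitian" "b \<in> hermitian"
  shows "cut_character T (a + \<i> *\<^sub>C b) = Complex (cut T a) (cut T b)"
  by (simp add: cut_character_def re_part_unique[OF assms])

text \<open>\<open>cut T\<close> is a real algebra homomorphism on the hermitian part; real and
  imaginary parts extend its laws to the complex algebra.\<close>

lemma cut_character_in_characters: "cut_character T \<in> characters"
proof -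
  have "cut_character T (f + g) = cut_character T f + cut_character T g
      \<and> cut_character T (f * g) = cut_character T f * cut_character T g
      \<and> cut_character T (z *\<^sub>C f) = z * cut_character T f" for f g z
  proof -
    define a b where "a = re_part f" and "b = im_part f"
    define c d where "c = re_part g" and "d = im_part g"
    define s t where "s = Re z" and "t = Im z"
    have H: "a \<in> hermitian" "b \<in> hermitian" "c \<in> hermitian" "d \<in> hermitian"
      by (simp_all add: a_def b_def c_def d_def re_part_hermitian im_part_hermitian)
    have f: "f = a + \<i> *\<^sub>C b" and g: "g = c + \<i> *\<^sub>C d"
      unfolding a_def b_def c_def d_def by (rule re_im_decomp)+
    have z: "z = of_real s + \<i> * of_real t"
      by (simp add: s_def t_def complex_eq)
    have 1: "f + g = (a + c) + \<i> *\<^sub>C (b + d)"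
      by (simp add: f g scaleC_add_right)
    have 2: "f * g = (a * c - b * d) + \<i> *\<^sub>C (a * d + b * c)"
      by (simp add: f g distrib_left distrib_right scaleC_add_right mult_scaleC_left
          mult_scaleC_right scaleC_i_i)
    have "z *\<^sub>C f = of_real s *\<^sub>C a + of_real s *\<^sub>C \<i> *\<^sub>C b
        + (\<i> *\<^sub>C of_real t *\<^sub>C a + \<i> *\<^sub>C of_real t *\<^sub>C \<i> *\<^sub>C b)"
      by (simp only: f z scaleC_add_left scaleC_add_right scaleC_scaleC[symmetric] add_ac)
    also have "of_real s *\<^sub>C \<i> *\<^sub>C b = \<i> *\<^sub>C of_real s *\<^sub>C b"
      by (simp add: scaleC_scaleC mult.commute)
    also have "of_real t *\<^sub>C \<i> *\<^sub>C b = \<i> *\<^sub>C of_real t *\<^sub>C b"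
      by (simp add: scaleC_scaleC mult.commute)
    finally have 3: "z *\<^sub>C f = (s *\<^sub>R a - t *\<^sub>R b) + \<i> *\<^sub>C (s *\<^sub>R b + t *\<^sub>R a)"
      by (simp add: scaleC_of_real scaleC_i_i scaleC_add_right)
    have cf: "cut_character T f = Complex (cut T a) (cut T b)"
      and cg: "cut_character T g = Complex (cut T c) (cut T d)"
      using H by (simp_all add: f g cut_character_re_im)
    have 4: "cut_character T (f + g) = Complex (cut T (a + c)) (cut T (b + d))"
      unfolding 1 using H by (intro cut_character_re_im hermitian_intros)
    have 5: "cut_character T (f * g) = Complex (cut T (a * c - b * d)) (cut T (a * d + b * c))"
      unfolding 2 using H by (intro cut_character_re_im hermitian_intros)
    have 6: "cut_character T (z *\<^sub>C f) = Complex (cut T (s *\<^sub>R a - t *\<^sub>R b)) (cut T (s *\<^sub>R b + t *\<^sub>R a))"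
      unfolding 3 using H by (intro cut_character_re_im hermitian_intros)
    show ?thesis
      unfolding 4 5 6 cf cg
      using H by (simp add: cut_add cut_diff cut_mult cut_scaleR hermitian_intros complex_eq_iff
          flip: s_def t_def)
  qed
  moreover have "cut_character T 1 \<noteq> 0"
    using cut_character_re_im[of 1 0] cut_of_real[of 1]
    by (auto simp: hermitian_intros complex_eq_iff scaleC_scaleC
        scaleC_diff_right[of \<i> 0 0, simplified])
  ultimately show ?thesis
    unfolding characters_def by blast
qed

lemma norm_cut_character_square: "(cmod (cut_character T f))\<^sup>2 = cut T (star f * f)"
proof -
  have H: "re_part f \<in> hermitian" "im_part f \<in> hermitian"
    by (simp_all add: re_part_hermitian im_part_hermitian)
  have "star f * f = re_part f * re_part f + im_part f * im_part f"
    using star_mult_re_im[OF H] by (simp flip: re_im_decomp)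
  then show ?thesis
    using H by (simp add: cut_add cut_mult hermitian_mult cmod_power2 cut_character_def)
      (simp add: power2_eq_square)
qed

end

lemma star_mult_self_sos: "star f * f \<in> sos"
proof -
  have H: "re_part f \<in> hermitian" "im_part f \<in> hermitian"
    by (simp_all add: re_part_hermitian im_part_hermitian)
  have "star f * f = re_part f * re_part f + im_part f * im_part f"
    using star_mult_re_im[OF H] by (simp flip: re_im_decomp)
  then show ?thesis
    using H by (simp add: sos.intros)
qed

text \<open>If the preordering generated by \<open>g\<close> contained \<open>- 1\<close>, then
  \<open>(- g) t = 1 + s\<close>, and \<open>preordering_positivstellensatz\<close> would make
  \<open>r^2 - a\<close> a sum of squares, forcing \<open>norm a <= r^2\<close> against the
  C*-identity. Hence a proper total extension contains \<open>g\<close>, and its character satisfies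
  \<open>|x f|^2 = cut T a >= r^2\<close>.\<close>

theorem character_attaining_norm:
  fixes f :: "'b::comm_unital_cstar_algebra"
  assumes r: "0 \<le> r" "r < norm f"
  obtains x where "x \<in> characters" "r \<le> cmod (x f)"
proof -
  define a where "a = star f * f"
  define g where "g = a - of_real (r\<^sup>2)"
  define T0 where "T0 = {s + g * t | s t. s \<in> sos \<and> t \<in> sos}"
  have a: "a \<in> sos"
    by (simp add: a_def star_mult_self_sos)
  have a_herm: "a \<in> hermitian"
    by (rule preordering_hermitian[OF preordering_sos a])
  have g: "g \<in> hermitian"
    unfolding g_def using a_herm by (intro hermitian_intros)
  have "- 1 \<notin> T0"
  proof
    assume "- 1 \<in> T0"
    then obtain s t where st: "s \<in> sos" "t \<in> sos" "- 1 = s + g * t"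
      by (auto simp: T0_def)
    have "(- g) * t = s - (s + g * t)"
      by simp
    also have "\<dots> = 1 + s"
      by (simp flip: st(3))
    finally have "(- g) * t = 1 + s" .
    then have "- g \<in> sos"
      by (rule preordering_positivstellensatz[OF preordering_sos hermitian_minus[OF g] st(1,2)])
    then have "norm a \<le> r\<^sup>2"
      using a by (intro norm_le_of_sos) (auto simp: g_def)
    moreover have "r\<^sup>2 < norm a"
      using r by (simp add: a_def cstar_identity power_strict_mono)
    ultimately show False by simp
  qed
  have "preordering T0"
    unfolding T0_def by (rule preordering_extend[OF preordering_sos g])
  then obtain T where T: "T0 \<subseteq> T" "preordering T" "- 1 \<notin> T"
    and total: "\<And>f. f \<in> hermitian \<Longrightarrow> f \<in> T \<or> - f \<in> T"
    using total_preordering_exists[of T0] \<open>- 1 \<notin> T0\<close> by blast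
  have "a - of_real (r\<^sup>2) \<in> T"
    using T(1) preordering_mem_extend[OF preordering_sos, of g] unfolding T0_def g_def by blast
  then have "r\<^sup>2 \<le> cut T a"
    using cut_ge[OF T(2,3)] total a_herm by blast
  also have "cut T a = (cmod (cut_character T f))\<^sup>2"
    unfolding a_def by (rule norm_cut_character_square[OF T(2,3) total, symmetric])
  finally have "r \<le> cmod (cut_character T f)"
    by (rule power2_le_imp_le) simp
  then show thesis
    using that cut_character_in_characters[OF T(2,3) total] by blast
qed

section \<open>Properties shared by all characters\<close>

context
  fixes x :: "'b::comm_unital_cstar_algebra \<Rightarrow> complex"
  assumes x: "x \<in> characters"
begin

lemma character_add: "x (f + g) = x f + x g"
  and character_scaleC: "x (z *\<^sub>C f) = z * x f"
  and character_mult: "x (f * g) = x f * x g"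
  using x unfolding characters_def by blast+

lemma character_zero: "x 0 = 0"
  using character_add[of 0 0] by simp

lemma character_one: "x 1 = 1"
proof -
  obtain f where "x f \<noteq> 0"
    using x unfolding characters_def by blast
  then show ?thesis
    using character_mult[of 1 f] by simp
qed

lemma character_diff: "x (f - g) = x f - x g"
  using character_add[of "f - g" g] by simp

lemma character_scaleR: "x (r *\<^sub>R f) = of_real r * x f"
  by (simp add: scaleR_scaleC character_scaleC)

text \<open>Otherwise \<open>g = f / x f\<close> has norm less than 1, so \<open>1 - g\<close> is
  invertible although \<open>x\<close> sends it to 0. Characters are thus automatically
  continuous.\<close>

lemma character_norm_le: "cmod (x f) \<le> norm f"
proof (rule ccontr)
  assume less: "\<not> cmod (x f) \<le> norm f"
  then have nz: "x f \<noteq> 0"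
    by auto
  define g where "g = inverse (x f) *\<^sub>C f"
  have xg: "x g = 1"
    using nz by (simp add: g_def character_scaleC)
  have "norm g = norm f / cmod (x f)"
    by (simp add: g_def norm_scaleC norm_inverse divide_inverse mult.commute)
  then have ng: "norm g < 1"
    using less nz by simp
  obtain k where "(1 - g) * k = 1"
    using one_minus_dvd_one[OF ng] by (metis dvd_def)
  then have "(x 1 - x g) * x k = x 1"
    by (simp flip: character_diff character_mult)
  then show False
    by (simp add: character_one xg)
qed

text \<open>Arens' argument: compare \<open>\<bar>x (h + i t)\<bar>\<^sup>2\<close> with \<open>\<parallel>h + i t\<parallel>\<^sup>2 = \<parallel>h\<^sup>2 + t\<^sup>2\<parallel>\<close> for large real \<open>t\<close>.\<close>
lemma character_hermitian:
  assumes h: "h \<in> hermitian"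
  shows "Im (x h) = 0"
proof (rule ccontr)
  define b where "b = Im (x h)"
  assume "Im (x h) \<noteq> 0"
  then have b: "b \<noteq> 0"
    by (simp add: b_def)
  \<comment> \<open>Chosen so that \<open>2 b t\<close> exceeds \<open>norm h ^ 2\<close> by 1,
    whatever the sign of \<open>b\<close>.\<close>
  define t where "t = ((norm h)\<^sup>2 + 1) / (2 * b)"
  have "x (of_real t) = of_real t"
    by (simp add: of_real_def character_scaleR character_one)
  then have "Im (x (h + \<i> *\<^sub>C of_real t)) = b + t"
    by (simp add: character_add character_scaleC b_def)
  then have "(b + t)\<^sup>2 \<le> (cmod (x (h + \<i> *\<^sub>C of_real t)))\<^sup>2"
    by (simp add: cmod_power2)
  also have "\<dots> \<le> (norm (h + \<i> *\<^sub>C of_real t))\<^sup>2"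
    by (simp add: character_norm_le power_mono)
  also have "\<dots> = norm (h * h + of_real t * of_real t)"
    using star_mult_re_im[OF h hermitian_of_real] by (metis cstar_identity)
  also have "\<dots> \<le> (norm h)\<^sup>2 + t\<^sup>2"
  proof (rule norm_triangle_le[OF add_mono])
    show "norm (h * h) \<le> (norm h)\<^sup>2"
      by (simp add: norm_mult_ineq power2_eq_square)
    show "norm (of_real t * of_real t :: 'b) \<le> t\<^sup>2"
      by (simp add: power2_eq_square abs_mult flip: of_real_mult)
  qed
  finally have "b\<^sup>2 + 2 * b * t \<le> (norm h)\<^sup>2"
    by (simp add: power2_sum)
  moreover have "2 * b * t = (norm h)\<^sup>2 + 1"
    using b by (simp add: t_def)
  ultimately show False
    using zero_le_power2[of b] by linarith
qed

lemma character_hermitian_of_real: "h \<in> hermitian \<Longrightarrow> x h = of_real (Re (x h))"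
  using character_hermitian by (simp add: complex_eq_iff)

lemma character_re_im: "x f = Complex (Re (x (re_part f))) (Re (x (im_part f)))"
proof -
  have "x f = x (re_part f) + \<i> * x (im_part f)"
    by (metis re_im_decomp character_add character_scaleC)
  then show ?thesis
    using character_hermitian[OF re_part_hermitian, of f] character_hermitian[OF im_part_hermitian, of f]
    by (simp add: complex_eq_iff)
qed

lemma character_star: "x (star f) = cnj (x f)"
proof -
  have H: "re_part f \<in> hermitian" "im_part f \<in> hermitian"
    by (simp_all add: re_part_hermitian im_part_hermitian)
  have "star f = star (re_part f + \<i> *\<^sub>C im_part f)"
    by (simp flip: re_im_decomp)
  also have "\<dots> = re_part f - \<i> *\<^sub>C im_part f"
    using H by (simp add: star_add star_scaleC hermitian_star scaleC_minus_left)
  finally have "x (star f) = x (re_part f) - \<i> * x (im_part f)"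
    by (simp add: character_diff character_scaleC)
  then show ?thesis
    using character_hermitian[OF H(1)] character_hermitian[OF H(2)]
    by (simp add: character_re_im[of f] complex_eq_iff)
qed

text \<open>\<open>x f - f\<close> is annihilated by \<open>x\<close>, which a divisor of 1 cannot
  be. This carries spectral positivity over to characters.\<close>

lemma character_spectrum: "x f \<in> spectrum f"
proof -
  have "\<not> (x f *\<^sub>C 1 - f) dvd 1"
  proof
    assume "(x f *\<^sub>C 1 - f) dvd 1"
    then obtain k where "1 = (x f *\<^sub>C 1 - f) * k"
      by (auto simp: dvd_def)
    then have "x 1 = x ((x f *\<^sub>C 1 - f) * k)"
      by simp
    then show False
      by (simp add: character_mult character_diff character_scaleC character_one)
  qed
  then show ?thesis
    by (simp add: spectrum_def)
qed

lemma character_quot: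
  assumes "g dvd 1"
  shows "x (quot f g) = x f / x g"
proof -
  obtain k where k: "g * k = 1"
    using assms by (metis dvd_def)
  have "(THE h. g * h = 1) = k"
  proof (rule the_equality)
    show "g * k = 1"
      by (rule k)
    fix h assume "g * h = 1"
    then have "k * (g * h) = k"
      by simp
    then show "h = k"
      using k by (metis mult.assoc mult.commute mult_1)
  qed
  moreover have xk: "x g * x k = 1"
    using k character_mult[of g k] character_one by simp
  then have "x k = 1 / x g"
    by (metis mult_eq_0_iff nonzero_eq_divide_eq mult.commute zero_neq_one)
  ultimately show ?thesis
    by (simp add: quot_def character_mult)
qed

end

section \<open>Cones of functions stable under a contracting map\<close>

text \<open>The name refers to \<open>p t <= t\<close>; having the two fixed points 0 and 1,
  \<open>p\<close> is not a contraction in the metric sense.\<close>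

locale contracting_map =
  fixes p :: "real \<Rightarrow> real"
  assumes p_cont: "continuous_on {0..} p"
    and p_mono: "0 \<le> s \<Longrightarrow> s \<le> t \<Longrightarrow> p s \<le> p t"
    and p_le: "0 \<le> t \<Longrightarrow> p t \<le> t"
    and p_0: "p 0 = 0"
    and p_1: "p 1 = 1"
    and p_fixed: "0 \<le> t \<Longrightarrow> p t = t \<Longrightarrow> t = 0 \<or> t = 1"
begin

lemma iterate_nonneg: "0 \<le> t \<Longrightarrow> 0 \<le> (p ^^ n) t"
proof (induction n)
  case (Suc n)
  then show ?case
    using p_mono[of 0 "(p ^^ n) t"] by (simp add: p_0)
qed simp

lemma iterate_mono: "0 \<le> s \<Longrightarrow> s \<le> t \<Longrightarrow> (p ^^ n) s \<le> (p ^^ n) t"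
  by (induction n) (auto intro: p_mono iterate_nonneg)

lemma iterate_one: "(p ^^ n) 1 = 1"
  by (induction n) (auto simp: p_1)

lemma iterate_le: "0 \<le> t \<Longrightarrow> (p ^^ n) t \<le> t"
  by (induction n) (auto intro: order_trans[OF p_le] iterate_nonneg)

text \<open>The iterates decrease and stay nonnegative, and continuity makes their limit a fixed
  point. The bound \<open>l <= t\<close> rules out the limit 1 for \<open>t < 1\<close>.\<close>

lemma iterate_converges:
  assumes t: "0 \<le> t"
  shows "\<exists>l\<in>{0, 1}. (\<lambda>n. (p ^^ n) t) \<longlonglongrightarrow> l \<and> l \<le> t"
proof -
  have "decseq (\<lambda>n. (p ^^ n) t)"
    by (rule decseq_SucI) (simp add: p_le iterate_nonneg t)
  then obtain l where l: "(\<lambda>n. (p ^^ n) t) \<longlonglongrightarrow> l"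
    using decseq_convergent[of _ 0] iterate_nonneg[OF t] by metis
  have l0: "0 \<le> l"
    using iterate_nonneg[OF t] by (intro LIMSEQ_le_const[OF l]) auto
  have lt: "l \<le> t"
    using iterate_le[OF t] by (intro LIMSEQ_le_const2[OF l]) auto
  have "(\<lambda>n. p ((p ^^ n) t)) \<longlonglongrightarrow> p l"
    using p_cont l l0 iterate_nonneg[OF t] by (intro continuous_on_tendsto_compose[of "{0..}" p]) auto
  moreover have "(\<lambda>n. p ((p ^^ n) t)) \<longlonglongrightarrow> l"
    using LIMSEQ_Suc[OF l] by simp
  ultimately have "p l = l"
    by (rule LIMSEQ_unique)
  then show ?thesis
    using p_fixed[OF l0] l lt by auto
qed

lemma iterate_tendsto_0: "0 \<le> t \<Longrightarrow> t < 1 \<Longrightarrow> (\<lambda>n. (p ^^ n) t) \<longlonglongrightarrow> 0"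
  using iterate_converges[of t] by auto

text \<open>Monotonicity and \<open>p 1 = 1\<close> keep the iterates at or above 1, which excludes
  the limit 0.\<close>

lemma iterate_tendsto_1:
  assumes "1 \<le> t"
  shows "(\<lambda>n. (p ^^ n) t) \<longlonglongrightarrow> 1"
proof -
  obtain l where l: "l \<in> {0, 1}" "(\<lambda>n. (p ^^ n) t) \<longlonglongrightarrow> l"
    using iterate_converges[of t] assms by auto
  have "1 \<le> l"
    using iterate_mono[of 1 t] assms by (intro LIMSEQ_le_const[OF l(2)]) (auto simp: iterate_one)
  then show ?thesis
    using l by auto
qed

end

text \<open>The assumption \<open>unit\<close> asks for a function that is at least 1 instead of the
  constant 1, because membership of constants is not known beforehand in the application.\<close>

locale function_cone = contracting_map p for p +
  fixes S :: "'a::topological_space set" and K :: "('a \<Rightarrow> real) set"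
  assumes compact: "compact S"
    and continuous: "f \<in> K \<Longrightarrow> continuous_on S f"
    and nonneg: "f \<in> K \<Longrightarrow> x \<in> S \<Longrightarrow> 0 \<le> f x"
    and zero: "(\<lambda>_. 0) \<in> K"
    and add: "f \<in> K \<Longrightarrow> g \<in> K \<Longrightarrow> (\<lambda>x. f x + g x) \<in> K"
    and scale: "0 < c \<Longrightarrow> f \<in> K \<Longrightarrow> (\<lambda>x. c * f x) \<in> K"
    and unit: "\<exists>e\<in>K. \<forall>x\<in>S. 1 \<le> e x"
    and apply_p: "f \<in> K \<Longrightarrow> (\<lambda>x. p (f x)) \<in> K"
begin

lemma sum: "finite I \<Longrightarrow> (\<And>i. i \<in> I \<Longrightarrow> u i \<in> K) \<Longrightarrow> (\<lambda>x. \<Sum>i\<in>I. u i x) \<in> K"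
  by (induction I rule: finite_induct) (auto intro: zero add)

lemma apply_iterate: "f \<in> K \<Longrightarrow> (\<lambda>x. (p ^^ n) (f x)) \<in> K"
  by (induction n) (auto dest: apply_p)

text \<open>Iterating \<open>p\<close> turns a function of the cone into an approximation of the indicator of the
  set where it is at least 1.\<close>
lemma sharpen:
  assumes f: "f \<in> K" and B: "B \<subseteq> S" and c: "c < 1" "\<And>x. x \<in> B \<Longrightarrow> f x \<le> c" and e: "0 < e"
  obtains u where "u \<in> K" "\<And>x. x \<in> S \<Longrightarrow> 1 \<le> f x \<Longrightarrow> 1 \<le> u x"
    "\<And>x. x \<in> S \<Longrightarrow> u x \<le> 1 + e" "\<And>x. x \<in> B \<Longrightarrow> u x \<le> e"
proof -
  have "bounded (f ` S)"
    using compact continuous[OF f] by (simp add: compact_continuous_image compact_imp_bounded)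
  then obtain M where M: "\<And>x. x \<in> S \<Longrightarrow> f x \<le> M"
    unfolding bounded_iff by (metis abs_le_D1 image_eqI real_norm_def)
  \<comment> \<open>By monotonicity two arguments control all points: the iterates at
    \<open>max 1 M\<close> bound the function on \<open>S\<close>, those at \<open>max 0 c\<close>
    bound it on \<open>B\<close>. The second maximum covers a negative \<open>c\<close>, possible
    for empty \<open>B\<close>.\<close>
  have "\<forall>\<^sub>F n in sequentially. (p ^^ n) (max 1 M) < 1 + e"
    using iterate_tendsto_1[of "max 1 M"] e by (intro order_tendstoD(2)[of _ 1]) auto
  moreover have "\<forall>\<^sub>F n in sequentially. (p ^^ n) (max 0 c) < e"
    using iterate_tendsto_0[of "max 0 c"] e c by (intro order_tendstoD(2)[of _ 0]) auto
  ultimately have "\<forall>\<^sub>F n in sequentially. (p ^^ n) (max 1 M) < 1 + e \<and> (p ^^ n) (max 0 c) < e"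
    by eventually_elim auto
  then obtain n where n: "(p ^^ n) (max 1 M) < 1 + e" "(p ^^ n) (max 0 c) < e"
    using eventually_happens'[OF sequentially_bot] by blast
  show thesis
  proof (rule that)
    show "(\<lambda>x. (p ^^ n) (f x)) \<in> K"
      by (rule apply_iterate[OF f])
    show "1 \<le> (p ^^ n) (f x)" if "1 \<le> f x" for x
      using iterate_mono[of 1 "f x" n] that by (simp add: iterate_one)
    show "(p ^^ n) (f x) \<le> 1 + e" if "x \<in> S" for x
      using iterate_mono[of "f x" "max 1 M" n] nonneg[OF f that] M[OF that] n by linarith
    show "(p ^^ n) (f x) \<le> e" if "x \<in> B" for x
      using iterate_mono[of "f x" "max 0 c" n] nonneg[OF f, of x] c(2)[OF that] that B n by force
  qed
qed

text \<open>The uniform gap between \<open>c\<close> and 1 is what iterating \<open>p\<close> widens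
  to nearly 0 against 1.\<close>

definition separated :: "'a set \<Rightarrow> 'a set \<Rightarrow> bool" where
  "separated A B \<longleftrightarrow> A \<subseteq> S \<and> B \<subseteq> S \<and>
     (\<exists>h\<in>K. \<exists>c<1. (\<forall>x\<in>A. 1 \<le> h x) \<and> (\<forall>x\<in>B. h x \<le> c))"

lemma separated_subset:
  "separated A B \<Longrightarrow> A' \<subseteq> A \<Longrightarrow> B' \<subseteq> B \<Longrightarrow> separated A' B'"
  unfolding separated_def by (meson order_trans subsetD)

lemma separated_empty_left: "B \<subseteq> S \<Longrightarrow> separated {} B"
  unfolding separated_def using zero by (auto intro!: bexI[of _ "\<lambda>_. 0"] exI[of _ 0])

lemma separated_empty_right: "A \<subseteq> S \<Longrightarrow> separated A {}"
  unfolding separated_def using unit by (auto intro!: exI[of _ 0])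

lemma separated_approx:
  assumes "separated A B" "0 < e"
  obtains u where "u \<in> K" "\<And>x. x \<in> A \<Longrightarrow> 1 \<le> u x"
    "\<And>x. x \<in> S \<Longrightarrow> u x \<le> 1 + e" "\<And>x. x \<in> B \<Longrightarrow> u x \<le> e"
proof -
  obtain h c where h: "h \<in> K" "c < 1" "\<And>x. x \<in> A \<Longrightarrow> 1 \<le> h x" "\<And>x. x \<in> B \<Longrightarrow> h x \<le> c"
    and S: "A \<subseteq> S" "B \<subseteq> S"
    using assms by (auto simp: separated_def)
  show thesis
    by (rule sharpen[OF h(1) S(2) h(2,4) assms(2)]) (use h S in \<open>auto intro!: that\<close>)
qed

text \<open>With errors \<open>1/4\<close> the average is at least 1 where both functions are, and
  at most \<open>(1/4 + 5/4) / 2 = 3/4\<close> where one of them is small.\<close>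

lemma separated_Int_Un:
  assumes "separated A B" "separated A' B'"
  shows "separated (A \<inter> A') (B \<union> B')"
proof -
  have S: "A \<subseteq> S" "A' \<subseteq> S" "B \<subseteq> S" "B' \<subseteq> S"
    using assms by (auto simp: separated_def)
  have e: "(0::real) < 1/4"
    by simp
  obtain u where u: "u \<in> K" "\<And>x. x \<in> A \<Longrightarrow> 1 \<le> u x"
      "\<And>x. x \<in> S \<Longrightarrow> u x \<le> 1 + 1/4" "\<And>x. x \<in> B \<Longrightarrow> u x \<le> 1/4"
    using separated_approx[OF assms(1) e] by blast
  obtain v where v: "v \<in> K" "\<And>x. x \<in> A' \<Longrightarrow> 1 \<le> v x"
      "\<And>x. x \<in> S \<Longrightarrow> v x \<le> 1 + 1/4" "\<And>x. x \<in> B' \<Longrightarrow> v x \<le> 1/4"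
    using separated_approx[OF assms(2) e] by blast
  have "(\<lambda>x. 1/2 * (u x + v x)) \<in> K"
    using u v by (intro scale add) auto
  moreover have "\<forall>x\<in>A \<inter> A'. 1 \<le> 1/2 * (u x + v x)"
    using u(2) v(2) by fastforce
  moreover have "1/2 * (u x + v x) \<le> 3/4" if "x \<in> B \<union> B'" for x
  proof -
    have "x \<in> S"
      using that S by auto
    then have "u x \<le> 1 + 1/4" "v x \<le> 1 + 1/4" "u x \<le> 1/4 \<or> v x \<le> 1/4"
      using u v that by auto
    then show ?thesis
      by argo
  qed
  ultimately show ?thesis
    unfolding separated_def using S by (auto intro!: bexI[of _ "\<lambda>x. 1/2 * (u x + v x)"] exI[of _ "3/4"])
qed

text \<open>The sum is at least 1 where one summand is, because the other is nonnegative; errors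
  \<open>1/4\<close> keep it at most \<open>1/2\<close> on \<open>B\<close>.\<close>

lemma separated_Un_left:
  assumes "separated A B" "separated A' B"
  shows "separated (A \<union> A') B"
proof -
  have S: "A \<subseteq> S" "A' \<subseteq> S" "B \<subseteq> S"
    using assms by (auto simp: separated_def)
  have e: "(0::real) < 1/4"
    by simp
  obtain u where u: "u \<in> K" "\<And>x. x \<in> A \<Longrightarrow> 1 \<le> u x"
      "\<And>x. x \<in> S \<Longrightarrow> u x \<le> 1 + 1/4" "\<And>x. x \<in> B \<Longrightarrow> u x \<le> 1/4"
    using separated_approx[OF assms(1) e] by blast
  obtain v where v: "v \<in> K" "\<And>x. x \<in> A' \<Longrightarrow> 1 \<le> v x"
      "\<And>x. x \<in> S \<Longrightarrow> v x \<le> 1 + 1/4" "\<And>x. x \<in> B \<Longrightarrow> v x \<le> 1/4"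
    using separated_approx[OF assms(2) e] by blast
  have "(\<lambda>x. u x + v x) \<in> K"
    using u v by (intro add) auto
  moreover have "1 \<le> u x + v x" if "x \<in> A \<union> A'" for x
    using u(2)[of x] v(2)[of x] that S nonneg[OF u(1), of x] nonneg[OF v(1), of x] by fastforce
  moreover have "u x + v x \<le> 1/2" if "x \<in> B" for x
    using u(4)[OF that] v(4)[OF that] by linarith
  ultimately show ?thesis
    unfolding separated_def using S by (auto intro!: bexI[of _ "\<lambda>x. u x + v x"] exI[of _ "1/2"])
qed

text \<open>Two levels \<open>f y < q < m < f x\<close> define the neighbourhoods: \<open>m\<close>
  is the midpoint of \<open>f y\<close> and \<open>f x\<close>, \<open>q\<close> that of
  \<open>f y\<close> and \<open>m\<close>. Dividing by \<open>m > 0\<close> moves the upper level to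
  1.\<close>

lemma separated_point_nhds:
  assumes xy: "x \<in> S" "y \<in> S" and f: "f \<in> K" "f y < f x"
  obtains U V where "open U" "open V" "x \<in> U" "y \<in> V" "separated (U \<inter> S) (V \<inter> S)"
proof -
  define m where "m = (f x + f y) / 2"
  define q where "q = (3 * f y + f x) / 4"
  have m: "f y < q" "q < m" "m < f x" "0 \<le> f y"
    using f nonneg[OF f(1) xy(2)] by (auto simp: m_def q_def field_simps)
  have "openin (top_of_set S) (S \<inter> f -` {m<..})" "openin (top_of_set S) (S \<inter> f -` {..<q})"
    using continuous[OF f(1)] by (auto intro: continuous_openin_preimage_gen)
  then obtain U V where U: "open U" "S \<inter> f -` {m<..} = S \<inter> U"
      and V: "open V" "S \<inter> f -` {..<q} = S \<inter> V"
    by (auto simp: openin_open)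
  have "(\<lambda>x. (1/m) * f x) \<in> K"
    using m f by (intro scale) auto
  moreover have "1 \<le> (1/m) * f z" if "z \<in> U \<inter> S" for z
  proof -
    have "z \<in> S \<inter> f -` {m<..}"
      using that U by auto
    then show ?thesis
      using m by auto
  qed
  moreover have "(1/m) * f z \<le> q/m" if "z \<in> V \<inter> S" for z
  proof -
    have "z \<in> S \<inter> f -` {..<q}"
      using that V by auto
    then show ?thesis
      using m by (auto simp: divide_simps)
  qed
  moreover have "q/m < 1"
    using m by auto
  ultimately have "separated (U \<inter> S) (V \<inter> S)"
    unfolding separated_def by (auto intro!: bexI[of _ "\<lambda>x. (1/m) * f x"] exI[of _ "q/m"])
  moreover have "x \<in> S \<inter> U" "y \<in> S \<inter> V"
    using xy m by (auto simp flip: U(2) V(2))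
  ultimately show thesis
    using that U V by auto
qed

text \<open>Two compactness passes. For fixed \<open>x\<close>, finitely many neighbourhoods cover
  \<open>B\<close>, and the matching neighbourhoods of \<open>x\<close> are intersected; then
  finitely many of the resulting neighbourhoods cover \<open>A\<close> and are united.\<close>

lemma separated_compact:
  assumes A: "compact A" "A \<subseteq> S" and B: "compact B" "B \<subseteq> S"
    and sep: "\<And>x y. x \<in> A \<Longrightarrow> y \<in> B \<Longrightarrow> \<exists>f\<in>K. f y < f x"
  shows "separated A B"
proof -
  have point: "\<exists>U. open U \<and> x \<in> U \<and> separated (U \<inter> S) B" if x: "x \<in> A" for x
  proof -
    have "\<exists>U V. open U \<and> open V \<and> x \<in> U \<and> y \<in> V \<and> separated (U \<inter> S) (V \<inter> S)" if "y \<in> B" for y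
      using separated_point_nhds[of x y] sep[OF x that] x that A B by (metis subsetD)
    then obtain U V where UV: "\<And>y. y \<in> B \<Longrightarrow> open (U y) \<and> open (V y) \<and> x \<in> U y \<and> y \<in> V y
        \<and> separated (U y \<inter> S) (V y \<inter> S)"
      by metis
    obtain Y where Y: "Y \<subseteq> B" "finite Y" "B \<subseteq> \<Union>(V ` Y)"
      using compactE_image[OF B(1), of B V] UV by (metis UN_I subsetI)
    have "separated (\<Inter>(U ` Y) \<inter> S) (\<Union>(V ` Y) \<inter> S)"
      using Y(2,1)
    proof (induction Y rule: finite_induct)
      case empty
      then show ?case
        by (simp add: separated_empty_right)
    next
      case (insert y Y)
      then have "separated ((U y \<inter> S) \<inter> (\<Inter>(U ` Y) \<inter> S)) ((V y \<inter> S) \<union> (\<Union>(V ` Y) \<inter> S))"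
        using UV[of y] by (intro separated_Int_Un) auto
      then show ?case
        by (rule separated_subset) auto
    qed
    then have "separated (\<Inter>(U ` Y) \<inter> S) B"
      by (rule separated_subset) (use Y B in auto)
    moreover have "open (\<Inter>(U ` Y))" "x \<in> \<Inter>(U ` Y)"
      using Y UV by auto
    ultimately show ?thesis
      by blast
  qed
  then obtain U where U: "\<And>x. x \<in> A \<Longrightarrow> open (U x) \<and> x \<in> U x \<and> separated (U x \<inter> S) B"
    by metis
  obtain X where X: "X \<subseteq> A" "finite X" "A \<subseteq> \<Union>(U ` X)"
    using compactE_image[OF A(1), of A U] U by (metis UN_I subsetI)
  have "separated (\<Union>(U ` X) \<inter> S) B"
    using X(2,1)
  proof (induction X rule: finite_induct)
    case empty
    then show ?case
      using B by (simp add: separated_empty_left)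
  next
    case (insert x X)
    then have "separated ((U x \<inter> S) \<union> (\<Union>(U ` X) \<inter> S)) B"
      using U[of x] by (intro separated_Un_left) auto
    then show ?case
      by (rule separated_subset) auto
  qed
  then show ?thesis
    by (rule separated_subset) (use X A in auto)
qed

text \<open>Layer-cake approximation: \<open>g\<close> is within \<open>d\<close> of \<open>d\<close> times the sum of the indicators of
  \<open>{g \<ge> (i + 1) d}\<close>.\<close>
theorem approximation:
  assumes g: "continuous_on S g" "\<And>x. x \<in> S \<Longrightarrow> 0 \<le> g x"
    and sep: "\<And>x y. x \<in> S \<Longrightarrow> y \<in> S \<Longrightarrow> g y < g x \<Longrightarrow> \<exists>f\<in>K. f y < f x"
    and e: "0 < e"
  obtains u where "u \<in> K" "\<And>x. x \<in> S \<Longrightarrow> \<bar>u x - g x\<bar> \<le> e"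
proof -
  define d where "d = e / 2"
  have d: "0 < d"
    using e by (simp add: d_def)
  have "bounded (g ` S)"
    using compact g(1) by (simp add: compact_continuous_image compact_imp_bounded)
  then obtain M where M: "\<And>x. x \<in> S \<Longrightarrow> g x \<le> M"
    unfolding bounded_iff by (metis abs_le_D1 image_eqI real_norm_def)
  \<comment> \<open>The \<open>n\<close> layers of height \<open>d\<close> reach the bound
    \<open>M\<close>, and \<open>Suc\<close> keeps \<open>n\<close> positive for the error
    \<open>1 / n\<close>.\<close>
  define n where "n = Suc (nat \<lceil>M / d\<rceil>)"
  have n: "0 < n" "M \<le> d * n"
  proof -
    have "M / d \<le> n"
      unfolding n_def by linarith
    then show "M \<le> d * n"
      using d by (simp add: field_simps)
  qed (simp add: n_def)
  define A where "A i = S \<inter> g -` {d * (i + 1)..}" for i :: nat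
  define B where "B i = S \<inter> g -` {..d * i}" for i :: nat
  have "separated (A i) (B i)" for i
  proof (rule separated_compact)
    have "closedin (top_of_set S) (A i)" "closedin (top_of_set S) (B i)"
      unfolding A_def B_def using g(1) by (auto intro!: continuous_closedin_preimage)
    then show "compact (A i)" "compact (B i)"
      using compact closedin_compact by blast+
    fix x y assume "x \<in> A i" "y \<in> B i"
    moreover have "d * i < d * (i + 1)"
      using d by simp
    ultimately show "\<exists>f\<in>K. f y < f x"
      using sep[of x y] by (auto simp: A_def B_def)
  qed (auto simp: A_def B_def)
  \<comment> \<open>Errors of \<open>1 / n\<close> add up to at most 1 over the \<open>n\<close>
    layers.\<close>
  then have "\<exists>u\<in>K. (\<forall>x\<in>A i. 1 \<le> u x) \<and> (\<forall>x\<in>S. u x \<le> 1 + 1 / n) \<and> (\<forall>x\<in>B i. u x \<le> 1 / n)" for i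
    using separated_approx[of "A i" "B i" "1 / n"] n(1)
    by (metis of_nat_0_less_iff zero_less_divide_1_iff)
  then obtain u where u: "\<And>i. u i \<in> K" "\<And>i x. x \<in> A i \<Longrightarrow> 1 \<le> u i x"
      "\<And>i x. x \<in> S \<Longrightarrow> u i x \<le> 1 + 1 / n" "\<And>i x. x \<in> B i \<Longrightarrow> u i x \<le> 1 / n"
    by metis
  show thesis
  proof (rule that)
    show "(\<lambda>x. d * (\<Sum>i<n. u i x)) \<in> K"
      using d u by (intro scale sum) auto
    fix x assume x: "x \<in> S"
    define j where "j = nat \<lfloor>g x / d\<rfloor>"
    have gx: "0 \<le> g x" "g x / d \<le> n"
      using g(2)[OF x] M[OF x] n d by (auto simp: field_simps)
    have j: "j \<le> g x / d" "g x / d < j + 1"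
      using gx d by (auto simp: j_def) linarith
    have jn: "j \<le> n"
      using j(1) gx(2) by linarith
    have "j = (\<Sum>i<j. 1::real)"
      by simp
    also have "\<dots> \<le> (\<Sum>i<j. u i x)"
    proof (intro sum_mono u(2))
      fix i assume "i \<in> {..<j}"
      then have "real (i + 1) \<le> g x / d"
        using j(1) by (metis (no_types, lifting) lessThan_iff Suc_eq_plus1 Suc_leI of_nat_le_iff order_trans)
      then show "x \<in> A i"
        using x d by (auto simp: A_def field_simps)
    qed
    also have "\<dots> \<le> (\<Sum>i<n. u i x)"
      using jn x by (intro sum_mono2) (auto intro: nonneg u)
    finally have lower: "j \<le> (\<Sum>i<n. u i x)" .
    \<comment> \<open>Beyond layer \<open>j\<close> only the error remains. Layer \<open>j\<close>
      may be cut by \<open>g x\<close> and is counted as full, so the layers up to \<open>j\<close>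
      contribute at most \<open>j + 1\<close> besides the total error 1.\<close>
    have "(\<Sum>i<n. u i x) \<le> (\<Sum>i<n. 1 / n + (if i \<in> {..j} then 1 else 0))"
    proof (intro sum_mono)
      fix i assume "i \<in> {..<n}"
      show "u i x \<le> 1 / n + (if i \<in> {..j} then 1 else 0)"
      proof (cases "i \<le> j")
        case True
        then show ?thesis
          using u(3)[OF x] by (auto simp: add.commute)
      next
        case False
        then have "real (j + 1) \<le> i"
          by linarith
        then have "g x / d \<le> i"
          using j by auto
        then have "x \<in> B i"
          using x d by (auto simp: B_def field_simps)
        then show ?thesis
          using u(4) False by auto
      qed
    qed
    also have "\<dots> = 1 + real (card ({..<n} \<inter> {..j}))"
      using n(1) by (simp add: sum.distrib sum.If_cases atMost_def)
    also have "\<dots> \<le> 1 + real (card {..j})"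
      by (intro add_left_mono of_nat_mono card_mono) auto
    finally have upper: "(\<Sum>i<n. u i x) \<le> j + 2"
      by simp
    have "\<bar>(\<Sum>i<n. u i x) - g x / d\<bar> \<le> 2"
      using lower upper j by linarith
    then have "d * \<bar>(\<Sum>i<n. u i x) - g x / d\<bar> \<le> d * 2"
      using d by (intro mult_left_mono) auto
    also have "d * \<bar>(\<Sum>i<n. u i x) - g x / d\<bar> = \<bar>d * (\<Sum>i<n. u i x) - g x\<bar>"
      using d by (simp add: abs_mult_pos' right_diff_distrib)
    finally show "\<bar>d * (\<Sum>i<n. u i x) - g x\<bar> \<le> e"
      by (simp add: d_def)
  qed
qed

end

section \<open>The two concrete contracting maps\<close>

lemma contracting_map_chi: "contracting_map (\<lambda>t. 2 * t\<^sup>2 / (1 + t\<^sup>2))"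
proof
  have pos: "0 < 1 + t\<^sup>2" for t :: real
    by (simp add: add_pos_nonneg)
  show "continuous_on {0..} (\<lambda>t::real. 2 * t\<^sup>2 / (1 + t\<^sup>2))"
    using pos by (intro continuous_intros) (metis less_irrefl)
  have eq: "2 * t\<^sup>2 / (1 + t\<^sup>2) = 2 - 2 / (1 + t\<^sup>2)" for t :: real
    using pos[of t] by (simp add: field_simps)
  show "2 * s\<^sup>2 / (1 + s\<^sup>2) \<le> 2 * t\<^sup>2 / (1 + t\<^sup>2)" if "0 \<le> s" "s \<le> t" for s t :: real
    unfolding eq using that pos by (intro diff_left_mono divide_left_mono add_left_mono power_mono) auto
  \<comment> \<open>The factorisation shows at once that the map lies below the identity on
    nonnegative reals and where its fixed points are.\<close>
  have diff: "t - 2 * t\<^sup>2 / (1 + t\<^sup>2) = t * (1 - t)\<^sup>2 / (1 + t\<^sup>2)" for t :: real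
    using pos[of t] by (simp add: field_simps power2_eq_square)
  show "2 * t\<^sup>2 / (1 + t\<^sup>2) \<le> t" if "0 \<le> t" for t :: real
  proof -
    have "0 \<le> t * (1 - t)\<^sup>2 / (1 + t\<^sup>2)"
      using that pos[of t] by simp
    then show ?thesis
      using diff[of t] by linarith
  qed
  show "t = 0 \<or> t = 1" if "2 * t\<^sup>2 / (1 + t\<^sup>2) = t" for t :: real
  proof -
    have "t * (1 - t)\<^sup>2 / (1 + t\<^sup>2) = 0"
      using diff[of t] that by linarith
    then show ?thesis
      using pos[of t] by auto
  qed
qed simp_all

lemma contracting_map_gam: "contracting_map (\<lambda>t. (2 * t / (1 + t))\<^sup>2)"
proof
  show "continuous_on {0..} (\<lambda>t::real. (2 * t / (1 + t))\<^sup>2)"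
    by (intro continuous_intros) auto
  show "(2 * s / (1 + s))\<^sup>2 \<le> (2 * t / (1 + t))\<^sup>2" if "0 \<le> s" "s \<le> t" for s t :: real
    using that by (intro power_mono) (auto simp: field_simps)
  \<comment> \<open>From \<open>(1 + t)^2 - 4 t = (1 - t)^2\<close>, with the same two uses as for
    the other map.\<close>
  have diff: "t - (2 * t / (1 + t))\<^sup>2 = t * (1 - t)\<^sup>2 / (1 + t)\<^sup>2" if "0 \<le> t" for t :: real
  proof -
    have "(1 + t)\<^sup>2 \<noteq> 0"
      using that by simp
    then have "t - (2 * t / (1 + t))\<^sup>2 = (t * (1 + t)\<^sup>2 - (2 * t)\<^sup>2) / (1 + t)\<^sup>2"
      by (simp add: power_divide diff_divide_distrib)
    also have "t * (1 + t)\<^sup>2 - (2 * t)\<^sup>2 = t * (1 - t)\<^sup>2"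
      by (simp add: power2_eq_square algebra_simps)
    finally show ?thesis .
  qed
  show "(2 * t / (1 + t))\<^sup>2 \<le> t" if "0 \<le> t" for t :: real
  proof -
    have "0 \<le> t * (1 - t)\<^sup>2 / (1 + t)\<^sup>2"
      using that by simp
    then show ?thesis
      using diff[OF that] by linarith
  qed
  show "t = 0 \<or> t = 1" if "0 \<le> t" "(2 * t / (1 + t))\<^sup>2 = t" for t :: real
  proof -
    have "t * (1 - t)\<^sup>2 / (1 + t)\<^sup>2 = 0"
      using diff[OF that(1)] that by linarith
    then show ?thesis
      using that(1) by auto
  qed
qed simp_all

section \<open>The Gelfand map\<close>

lemma continuous_on_evaluation: "continuous_on A (\<lambda>x. x f)"
  by (rule continuous_on_subset[OF continuous_on_product_coordinates]) simp

text \<open>Evaluations are the coordinate projections of the function space with its product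
  topology, so the topology they generate is the subspace topology.\<close>

lemma weak_star_topology_eq:
  "weak_star_topology = top_of_set (characters :: ('b::comm_unital_cstar_algebra \<Rightarrow> complex) set)"
    (is "?W = ?X")
proof -
  have evaluation: "continuous_map ?W euclidean (\<lambda>x. x f)" for f :: 'b
  proof -
    have "openin ?W {x \<in> characters. x f \<in> U}" if "open U" for U
      unfolding weak_star_topology_def using that by (intro topology_generated_by_Basis) blast
    then show ?thesis
      by (simp add: continuous_map_def)
  qed
  have "continuous_map ?W euclidean id"
    unfolding euclidean_product_topology[symmetric] id_def
    by (rule continuous_map_coordinatewise_then_product) (auto intro: evaluation)
  then have 1: "openin ?W U" if "openin ?X U" for U
    using that unfolding openin_open by (auto simp: continuous_map_def Int_def)
  have "continuous_map ?X ?W id"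
    unfolding weak_star_topology_def
  proof (rule continuous_on_generated_topo)
    fix U :: "('b \<Rightarrow> complex) set"
    assume "U \<in> {{x \<in> characters. x f \<in> U} | f U. open U}"
    then obtain f V where U: "U = {x \<in> characters. x f \<in> V}" and V: "open V"
      by blast
    have "openin ?X (characters \<inter> (\<lambda>x. x f) -` V)"
      by (rule continuous_openin_preimage_gen[OF continuous_on_evaluation V])
    then show "openin ?X (id -` U \<inter> topspace ?X)"
      by (rule back_subst[of "openin ?X"]) (auto simp: U)
  qed (auto simp flip: weak_star_topology_def)
  then have 2: "openin ?X U" if "openin ?W U" for U
    using that openin_subset[OF that] by (auto simp: continuous_map_def Collect_conj_eq Int_absorb1)
  show ?thesis
    unfolding topology_eq using 1 2 by blast
qed

text \<open>Banach-Alaoglu argument: the characters form a closed subset of a product of discs of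
  radius \<open>norm f\<close>, compact by Tychonoff.\<close>

lemma compact_characters: "compact (characters :: ('b::comm_unital_cstar_algebra \<Rightarrow> complex) set)"
proof -
  define D :: "('b \<Rightarrow> complex) set" where "D = PiE UNIV (\<lambda>f. cball 0 (norm f))"
  \<comment> \<open>Being nonzero is not a closed condition; \<open>x 1 = 1\<close> is an equivalent
    one that is.\<close>
  define E :: "('b \<Rightarrow> complex) set" where
    "E = (\<Inter>f g. {x. x (f + g) = x f + x g}) \<inter> (\<Inter>a f. {x. x (a *\<^sub>C f) = a * x f}) \<inter>
      (\<Inter>f g. {x. x (f * g) = x f * x g}) \<inter> {x. x 1 = 1}"
  have "compactin (product_topology (\<lambda>_. euclidean) UNIV) D"
    unfolding D_def by (simp add: compactin_PiE)
  then have "compact D"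
    by (simp add: euclidean_product_topology)
  moreover have "closed E"
    unfolding E_def
    by (intro closed_Int closed_INT ballI closed_Collect_eq continuous_intros continuous_on_evaluation)
  moreover have "characters = D \<inter> E"
  proof (intro equalityI subsetI)
    fix x :: "'b \<Rightarrow> complex" assume x: "x \<in> characters"
    show "x \<in> D \<inter> E"
      using character_norm_le[OF x] character_add[OF x] character_scaleC[OF x] character_mult[OF x]
        character_one[OF x] by (auto simp: D_def E_def)
  next
    fix x assume "x \<in> D \<inter> E"
    then show "x \<in> characters"
      by (auto simp: E_def characters_def intro!: exI[of _ 1])
  qed
  ultimately show ?thesis
    using closed_Int_compact[of E D] by (simp add: Int_commute)
qed

lemma character_bounded_linear: "x \<in> characters \<Longrightarrow> bounded_linear x"
  by (rule bounded_linear_intro[where K = 1])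
    (auto simp: character_add character_scaleR character_norm_le scaleR_conv_of_real[where 'a = complex])

text \<open>Characters are only known to reach each \<open>r < norm f\<close>, hence the approach
  from below. The existence of a character gives \<open>0 <= e\<close>, which settles negative
  \<open>r\<close>.\<close>

lemma norm_le_of_characters:
  fixes f :: "'b::comm_unital_cstar_algebra"
  assumes "\<And>x. x \<in> characters \<Longrightarrow> cmod (x f) \<le> e"
  shows "norm f \<le> e"
proof -
  obtain x :: "'b \<Rightarrow> complex" where "x \<in> characters"
    using character_attaining_norm[of 0 "1::'b"] by auto
  then have e: "0 \<le> e"
    using assms norm_ge_zero order_trans by blast
  show ?thesis
  proof (rule dense_le)
    fix r assume r: "r < norm f"
    show "r \<le> e"
    proof (cases "0 \<le> r")
      case True
      then obtain x where "x \<in> characters" "r \<le> cmod (x f)"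
        using character_attaining_norm[OF True r] by blast
      then show ?thesis
        using assms order_trans by blast
    qed (use e in auto)
  qed
qed

lemma characters_eqI:
  assumes "\<And>x. x \<in> characters \<Longrightarrow> x f = x g"
  shows "f = (g :: 'b::comm_unital_cstar_algebra)"
proof -
  have "norm (f - g) \<le> 0"
    by (rule norm_le_of_characters) (simp add: assms character_diff)
  then show ?thesis
    by simp
qed

lemma characters_nonempty: "(characters :: ('b::comm_unital_cstar_algebra \<Rightarrow> complex) set) \<noteq> {}"
  using character_attaining_norm[of 0 "1::'b"] by auto

lemma sup_norm_gelfand:
  fixes f :: "'b::comm_unital_cstar_algebra"
  shows "sup_norm weak_star_topology (gelfand f) = norm f"
proof -
  have "(SUP x\<in>characters. cmod (x f)) = norm f"
  proof (rule antisym)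
    show "(SUP x\<in>characters. cmod (x f)) \<le> norm f"
      by (rule cSUP_least) (auto simp: characters_nonempty character_norm_le)
    have "bdd_above ((\<lambda>x. cmod (x f)) ` characters)"
      by (rule bdd_aboveI2) (rule character_norm_le)
    then show "norm f \<le> (SUP x\<in>characters. cmod (x f))"
      by (intro norm_le_of_characters cSUP_upper)
  qed
  moreover have "(SUP x\<in>characters. cmod (gelfand f x)) = (SUP x\<in>characters. cmod (x f))"
    by (rule SUP_cong) (auto simp: gelfand_def)
  ultimately show ?thesis
    by (simp add: sup_norm_def)
qed

text \<open>Uniform closeness on characters is closeness in norm, so the approximants form a Cauchy
  sequence, and its limit lies in the closed set \<open>D\<close>. Hermitian elements take real
  values, so control of \<open>Re\<close> suffices.\<close>

lemma gelfand_limit: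
  fixes D :: "'b::comm_unital_cstar_algebra set"
  assumes D: "closed D" "D \<subseteq> hermitian"
    and approx: "\<And>e. 0 < e \<Longrightarrow> \<exists>h\<in>D. \<forall>x\<in>characters. \<bar>Re (x h) - g x\<bar> \<le> e"
  obtains h where "h \<in> D" "\<And>x. x \<in> characters \<Longrightarrow> x h = of_real (g x)"
proof -
  have "\<exists>h\<in>D. \<forall>x\<in>characters. \<bar>Re (x h) - g x\<bar> \<le> inverse (Suc n)" for n
    by (rule approx) simp
  then obtain u where u: "\<And>n. u n \<in> D" "\<And>n x. x \<in> characters \<Longrightarrow> \<bar>Re (x (u n)) - g x\<bar> \<le> inverse (Suc n)"
    by metis
  have gu: "cmod (x (u n) - of_real (g x)) \<le> inverse (Suc n)" if x: "x \<in> characters" for x n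
  proof -
    have "u n \<in> hermitian"
      using u(1) D(2) by blast
    then have "x (u n) - of_real (g x) = of_real (Re (x (u n)) - g x)"
      using character_hermitian_of_real[OF x, of "u n"] by simp
    then show ?thesis
      using u(2)[OF x, of n] by (simp only: norm_of_real)
  qed
  have "Cauchy u"
  proof (rule metric_CauchyI)
    fix e :: real assume "0 < e"
    then obtain M where M: "inverse (Suc M) < e / 2"
      using reals_Archimedean[of "e / 2"] by auto
    have "dist (u m) (u n) < e" if "M \<le> m" "M \<le> n" for m n
    proof -
      have "norm (u m - u n) \<le> inverse (Suc m) + inverse (Suc n)"
      proof (rule norm_le_of_characters)
        fix x :: "'b \<Rightarrow> complex" assume x: "x \<in> characters"
        have "x (u m - u n) = (x (u m) - of_real (g x)) - (x (u n) - of_real (g x))"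
          by (simp add: character_diff[OF x])
        then show "cmod (x (u m - u n)) \<le> inverse (Suc m) + inverse (Suc n)"
          using gu[OF x, of m] gu[OF x, of n] norm_triangle_ineq4 order_trans add_mono by metis
      qed
      also have "\<dots> \<le> inverse (Suc M) + inverse (Suc M)"
        using that by (intro add_mono) (auto intro: le_imp_inverse_le)
      also have "\<dots> < e"
        using M by linarith
      finally show ?thesis
        by (simp add: dist_norm)
    qed
    then show "\<exists>M. \<forall>m\<ge>M. \<forall>n\<ge>M. dist (u m) (u n) < e"
      by blast
  qed
  then obtain h where h: "u \<longlonglongrightarrow> h"
    using Cauchy_convergent convergent_def by blast
  show thesis
  proof (rule that)
    show "h \<in> D"
      using D(1) u(1) h by (rule closed_sequentially)
    fix x :: "'b \<Rightarrow> complex" assume x: "x \<in> characters"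
    have "(\<lambda>n. x (u n) - of_real (g x)) \<longlonglongrightarrow> 0"
      by (rule Lim_null_comparison[OF always_eventually LIMSEQ_inverse_real_of_nat]) (use gu[OF x] in blast)
    then have "(\<lambda>n. x (u n)) \<longlonglongrightarrow> of_real (g x)"
      by (simp add: LIM_zero_iff)
    moreover have "(\<lambda>n. x (u n)) \<longlonglongrightarrow> x h"
      by (rule bounded_linear.tendsto[OF character_bounded_linear[OF x] h])
    ultimately show "x h = of_real (g x)"
      by (rule LIMSEQ_unique[rotated])
  qed
qed

lemma hermitian_if_real:
  assumes "\<And>x. x \<in> characters \<Longrightarrow> Im (x f) = 0"
  shows "f \<in> hermitian"
proof -
  have "f = star f"
    by (rule characters_eqI) (simp add: assms character_star complex_eq_iff)
  then show ?thesis
    by (simp add: hermitian_def)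
qed

text \<open>Write \<open>1 + a = c (1 - u)\<close>. Characters take values in
  \<open>[0, c - 1]\<close> at \<open>a = h * h\<close>, hence in \<open>[0, (c - 1) / c]\<close> at
  \<open>u\<close>, so \<open>norm u < 1\<close>.\<close>

lemma one_plus_square_dvd_one:
  fixes h :: "'b::comm_unital_cstar_algebra"
  assumes h: "h \<in> hermitian"
  shows "(1 + h\<^sup>2) dvd 1"
proof -
  define a where "a = h * h"
  define c where "c = norm a + 1"
  define u where "u = (1 / c) *\<^sub>R ((c - 1) *\<^sub>R 1 - a)"
  have c: "0 < c"
    unfolding c_def using norm_ge_zero[of a] by linarith
  have "norm u \<le> (c - 1) / c"
  proof (rule norm_le_of_characters)
    fix x :: "'b \<Rightarrow> complex" assume x: "x \<in> characters"
    define t where "t = (Re (x h))\<^sup>2"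
    have xa: "x a = of_real t"
      using character_hermitian_of_real[OF x h] by (simp add: a_def t_def character_mult[OF x] power2_eq_square)
    then have "t \<le> c - 1"
      using character_norm_le[OF x, of a] by (simp add: c_def)
    moreover have "0 \<le> t"
      by (simp add: t_def)
    ultimately have "\<bar>(c - 1 - t) / c\<bar> \<le> (c - 1) / c"
      using c by (simp add: divide_right_mono)
    moreover have "x u = of_real ((c - 1 - t) / c)"
      by (simp add: u_def character_scaleR[OF x] character_diff[OF x] character_one[OF x] xa)
    ultimately show "cmod (x u) \<le> (c - 1) / c"
      by (simp only: norm_of_real)
  qed
  also have "\<dots> < 1"
    using c by simp
  finally obtain k where k: "(1 - u) * k = 1"
    using one_minus_dvd_one by (metis dvd_def)
  have "1 - u = (1 / c) *\<^sub>R (c *\<^sub>R 1 - ((c - 1) *\<^sub>R 1 - a))"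
    using c by (simp add: u_def scaleR_diff_right)
  also have "\<dots> = (1 / c) *\<^sub>R (1 + a)"
    by (simp add: scaleR_diff_left)
  finally have "(1 + a) * ((1 / c) *\<^sub>R k) = 1"
    using k by simp
  then show ?thesis
    unfolding a_def power2_eq_square by (metis dvdI)
qed

lemma character_chi:
  assumes x: "x \<in> characters" and h: "h \<in> hermitian"
  shows "x (chi h) = of_real (2 * (Re (x h))\<^sup>2 / (1 + (Re (x h))\<^sup>2))"
proof -
  have "x (chi h) = 2 * (x h)\<^sup>2 / (1 + (x h)\<^sup>2)"
    unfolding chi_def character_quot[OF x one_plus_square_dvd_one[OF h]]
    by (simp only: mult_2 character_add[OF x] character_mult[OF x] character_one[OF x] power2_eq_square)
  also have "\<dots> = of_real (2 * (Re (x h))\<^sup>2 / (1 + (Re (x h))\<^sup>2))"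
    by (subst (1 2) character_hermitian_of_real[OF x h]) simp
  finally show ?thesis .
qed

lemma character_gam:
  assumes x: "x \<in> characters" and h: "h \<in> hermitian" and d: "(1 + h) dvd 1"
  shows "x (gam h) = of_real ((2 * Re (x h) / (1 + Re (x h)))\<^sup>2)"
proof -
  have "x (2 * h) = 2 * x h"
    by (simp only: mult_2 character_add[OF x])
  then have "x (gam h) = (2 * x h / (1 + x h))\<^sup>2"
    by (simp only: gam_def power2_eq_square character_mult[OF x, of "quot _ _"] character_quot[OF x d]
        character_add[OF x] character_one[OF x])
  also have "\<dots> = of_real ((2 * Re (x h) / (1 + Re (x h)))\<^sup>2)"
    by (subst (1 2) character_hermitian_of_real[OF x h]) simp
  finally show ?thesis .
qed

text \<open>\<open>C_apply\<close> asks only for some element of \<open>C\<close> whose values at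
  characters are the images under \<open>p\<close>, so that \<open>chi\<close> and
  \<open>gam\<close> are handled alike.\<close>

locale hermitian_cone = contracting_map p for p +
  fixes C :: "'b::comm_unital_cstar_algebra set"
  assumes closed: "closed C"
    and C_hermitian: "C \<subseteq> hermitian"
    and C_zero: "0 \<in> C"
    and C_add: "f \<in> C \<Longrightarrow> g \<in> C \<Longrightarrow> f + g \<in> C"
    and C_scale: "0 < c \<Longrightarrow> f \<in> C \<Longrightarrow> c *\<^sub>R f \<in> C"
    and C_nonneg: "f \<in> C \<Longrightarrow> x \<in> characters \<Longrightarrow> 0 \<le> Re (x f)"
    and C_unit: "\<exists>e\<in>C. \<forall>x\<in>characters. 1 \<le> Re (x e)"
    and C_apply: "f \<in> C \<Longrightarrow> \<exists>f'\<in>C. \<forall>x\<in>characters. Re (x f') = p (Re (x f))"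
begin

text \<open>Only values on \<open>characters\<close> count, so pointwise sums, multiples and images
  under \<open>p\<close> stay in \<open>K\<close> whatever they are elsewhere.\<close>

definition K :: "(('b \<Rightarrow> complex) \<Rightarrow> real) set" where
  "K = {u. \<exists>f\<in>C. \<forall>x\<in>characters. u x = Re (x f)}"

lemma function_cone_K: "function_cone p characters K"
proof
  show "compact (characters :: ('b \<Rightarrow> complex) set)"
    by (rule compact_characters)
next
  fix u assume "u \<in> K"
  then obtain h where u: "\<And>x. x \<in> characters \<Longrightarrow> u x = Re (x h)"
    by (auto simp: K_def)
  have "continuous_on characters (\<lambda>x. Re (x h))"
    by (intro continuous_on_Re continuous_on_evaluation)
  then show "continuous_on characters u"
    by (rule continuous_on_eq) (simp add: u)
next
  fix u and x :: "'b \<Rightarrow> complex" assume "u \<in> K" "x \<in> characters"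
  then show "0 \<le> u x"
    using C_nonneg by (auto simp: K_def)
next
  have "\<forall>x\<in>characters. 0 = Re (x (0 :: 'b))"
    by (simp add: character_zero)
  then show "(\<lambda>_. 0) \<in> K"
    unfolding K_def using C_zero by blast
next
  fix u v assume "u \<in> K" "v \<in> K"
  then obtain f g where C: "f \<in> C" "g \<in> C"
    and uv: "\<And>x. x \<in> characters \<Longrightarrow> u x = Re (x f)" "\<And>x. x \<in> characters \<Longrightarrow> v x = Re (x g)"
    by (auto simp: K_def)
  have "\<forall>x\<in>characters. u x + v x = Re (x (f + g))"
    by (simp add: uv character_add)
  then show "(\<lambda>x. u x + v x) \<in> K"
    unfolding K_def using C_add[OF C] by blast
next
  fix u and c :: real assume c: "0 < c" and "u \<in> K"
  then obtain f where C: "f \<in> C" and u: "\<And>x. x \<in> characters \<Longrightarrow> u x = Re (x f)"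
    by (auto simp: K_def)
  have "\<forall>x\<in>characters. c * u x = Re (x (c *\<^sub>R f))"
    by (simp add: u character_scaleR)
  then show "(\<lambda>x. c * u x) \<in> K"
    unfolding K_def using C_scale[OF c C] by blast
next
  obtain e where "e \<in> C" "\<forall>x\<in>characters. 1 \<le> Re (x e)"
    using C_unit by blast
  then show "\<exists>e\<in>K. \<forall>x\<in>characters. 1 \<le> e x"
    unfolding K_def by (intro bexI[of _ "\<lambda>x. Re (x e)"]) auto
next
  fix u assume "u \<in> K"
  then obtain f where C: "f \<in> C" and u: "\<And>x. x \<in> characters \<Longrightarrow> u x = Re (x f)"
    by (auto simp: K_def)
  obtain f' where "f' \<in> C" "\<forall>x\<in>characters. Re (x f') = p (Re (x f))"
    using C_apply[OF C] by blast
  then show "(\<lambda>x. p (u x)) \<in> K"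
    unfolding K_def using u by (auto intro!: bexI[of _ f'])
qed

text \<open>The hypothesis \<open>sep\<close> is isotony in contrapositive form. Closedness of
  \<open>C\<close> turns uniform approximation into exact representation through
  \<open>gelfand_limit\<close>.\<close>

theorem isotone_represented:
  assumes g: "continuous_on characters g" "\<And>x. x \<in> characters \<Longrightarrow> 0 \<le> g x"
    and sep: "\<And>x y. x \<in> characters \<Longrightarrow> y \<in> characters \<Longrightarrow> g y < g x \<Longrightarrow> \<exists>f\<in>C. Re (y f) < Re (x f)"
  obtains h where "h \<in> C" "\<And>x. x \<in> characters \<Longrightarrow> x h = of_real (g x)"
proof -
  interpret function_cone p characters K
    by (rule function_cone_K)
  have "\<exists>h\<in>C. \<forall>x\<in>characters. \<bar>Re (x h) - g x\<bar> \<le> e" if e: "0 < e" for e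
  proof -
    have "\<exists>u\<in>K. u y < u x" if xy: "x \<in> characters" "y \<in> characters" "g y < g x" for x y
    proof -
      obtain f where "f \<in> C" "Re (y f) < Re (x f)"
        using sep[OF xy] by blast
      then show ?thesis
        unfolding K_def by (intro bexI[of _ "\<lambda>x. Re (x f)"]) auto
    qed
    then obtain u where u: "u \<in> K" "\<And>x. x \<in> characters \<Longrightarrow> \<bar>u x - g x\<bar> \<le> e"
      using approximation[OF g(1) g(2) _ e] by metis
    then obtain f where "f \<in> C" "\<forall>x\<in>characters. u x = Re (x f)"
      by (auto simp: K_def)
    then show ?thesis
      using u(2) by (intro bexI[of _ f]) auto
  qed
  then show thesis
    using gelfand_limit[OF closed C_hermitian, of g] that by blast
qed

end

section \<open>Surjectivity of the Gelfand map\<close>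

definition positive_elements :: "'b::comm_unital_cstar_algebra set" where
  "positive_elements = {h \<in> hermitian. \<forall>x\<in>characters. 0 \<le> Re (x h)}"

text \<open>The map of \<open>chi\<close> serves here because \<open>1 + h^2\<close> is invertible
  for every hermitian \<open>h\<close>; \<open>chi h\<close> takes nonnegative real values at
  characters, so it is again positive.\<close>

lemma hermitian_cone_positive_elements:
  "hermitian_cone (\<lambda>t. 2 * t\<^sup>2 / (1 + t\<^sup>2)) (positive_elements :: 'b::comm_unital_cstar_algebra set)"
proof (intro hermitian_cone.intro contracting_map_chi hermitian_cone_axioms.intro)
  have eq: "positive_elements = hermitian \<inter> (\<Inter>x\<in>characters. {h :: 'b. 0 \<le> Re (x h)})"
    by (auto simp: positive_elements_def)
  have "closed {h :: 'b. 0 \<le> Re (x h)}" if "x \<in> characters" for x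
    using linear_continuous_on[OF character_bounded_linear[OF that]]
    by (intro closed_Collect_le continuous_intros)
  then show "closed (positive_elements :: 'b set)"
    unfolding eq by (intro closed_Int closed_INT ballI closed_hermitian)
  have "1 \<in> (positive_elements :: 'b set)" "\<forall>x\<in>characters. 1 \<le> Re (x (1 :: 'b))"
    by (auto simp: positive_elements_def character_one hermitian_one)
  then show "\<exists>e\<in>positive_elements. \<forall>x\<in>characters. 1 \<le> Re (x (e :: 'b))"
    by blast
  fix f :: 'b assume f: "f \<in> positive_elements"
  then have "chi f \<in> hermitian"
    by (intro hermitian_if_real) (simp add: positive_elements_def character_chi)
  then have "chi f \<in> positive_elements"
    using f by (simp add: positive_elements_def character_chi)
  moreover have "\<forall>x\<in>characters. Re (x (chi f)) = 2 * (Re (x f))\<^sup>2 / (1 + (Re (x f))\<^sup>2)"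
    using f by (simp add: positive_elements_def character_chi)
  ultimately show "\<exists>f'\<in>positive_elements. \<forall>x\<in>characters. Re (x f') = 2 * (Re (x f))\<^sup>2 / (1 + (Re (x f))\<^sup>2)"
    by blast
qed (auto simp: positive_elements_def character_add character_scaleR character_zero intro: hermitian_intros)

text \<open>Positive elements separate characters in both directions: a separating hermitian element
  can be given either sign and then shifted by its norm. So \<open>isotone_represented\<close>
  applies to every continuous function made nonnegative by the shift \<open>M\<close>.\<close>

lemma gelfand_real_surj:
  fixes g :: "('b::comm_unital_cstar_algebra \<Rightarrow> complex) \<Rightarrow> real"
  assumes g: "continuous_on characters g"
  obtains h where "h \<in> hermitian" "\<And>x. x \<in> characters \<Longrightarrow> x h = of_real (g x)"
proof -
  interpret hermitian_cone "\<lambda>t. 2 * t\<^sup>2 / (1 + t\<^sup>2)" "positive_elements :: 'b set"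
    by (rule hermitian_cone_positive_elements)
  have "bounded (g ` characters)"
    by (intro compact_imp_bounded compact_continuous_image compact_characters g)
  then obtain M where M: "\<And>x. x \<in> characters \<Longrightarrow> \<bar>g x\<bar> \<le> M"
    unfolding bounded_iff by (metis image_eqI real_norm_def)
  have separate: "\<exists>f\<in>positive_elements. Re (y f) < Re (x f)"
    if xy: "x \<in> characters" "y \<in> characters" "x \<noteq> y" for x y :: "'b \<Rightarrow> complex"
  proof -
    obtain f where "x f \<noteq> y f"
      using xy(3) by blast
    then have "Re (x (re_part f)) \<noteq> Re (y (re_part f)) \<or> Re (x (im_part f)) \<noteq> Re (y (im_part f))"
      using character_re_im[OF xy(1), of f] character_re_im[OF xy(2), of f] by auto
    then obtain h where h: "h \<in> hermitian" "Re (x h) \<noteq> Re (y h)"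
      using re_part_hermitian im_part_hermitian by blast
    define k where "k = (if Re (y h) < Re (x h) then h else - h)"
    have k: "k \<in> hermitian" "Re (y k) < Re (x k)"
      using h xy character_diff[OF xy(1), of 0 h] character_diff[OF xy(2), of 0 h]
      by (auto simp: k_def hermitian_minus character_zero)
    have val: "Re (z (norm k *\<^sub>R 1 + k)) = norm k + Re (z k)" if "z \<in> characters" for z
      using that by (simp add: character_add character_scaleR character_one)
    have "norm k *\<^sub>R 1 + k \<in> positive_elements"
    proof -
      have "0 \<le> norm k + Re (z k)" if "z \<in> characters" for z
        using character_norm_le[OF that, of k] abs_Re_le_cmod[of "z k"] by linarith
      then show ?thesis
        using k by (auto simp: positive_elements_def val intro!: hermitian_intros)
    qed
    then show ?thesis
      using k val[OF xy(1)] val[OF xy(2)] by (intro bexI[of _ "norm k *\<^sub>R 1 + k"]) auto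
  qed
  have "continuous_on characters (\<lambda>x. g x + M)"
    using g by (intro continuous_intros)
  moreover have "0 \<le> g x + M" if "x \<in> characters" for x
    using M[OF that] by linarith
  ultimately obtain h where h: "h \<in> positive_elements" "\<And>x. x \<in> characters \<Longrightarrow> x h = of_real (g x + M)"
    using isotone_represented[of "\<lambda>x. g x + M"] separate by (metis less_irrefl)
  show thesis
  proof (rule that)
    show "h - M *\<^sub>R 1 \<in> hermitian"
      using h(1) by (auto simp: positive_elements_def intro!: hermitian_intros)
    show "x (h - M *\<^sub>R 1) = of_real (g x)" if "x \<in> characters" for x
      using that by (simp add: character_diff character_scaleR character_one h(2))
  qed
qed

lemma cfunctions_weak_star:
  "cfunctions weak_star_topology = {u \<in> extensional characters. continuous_on characters u}"
  by (simp add: cfunctions_def) (simp add: weak_star_topology_eq)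

lemma gelfand_bij: "bij_betw (gelfand :: 'b::comm_unital_cstar_algebra \<Rightarrow> _) UNIV (cfunctions weak_star_topology)"
  unfolding bij_betw_def
proof (intro conjI equalityI subsetI)
  show "inj (gelfand :: 'b \<Rightarrow> _)"
  proof (rule injI)
    fix f g :: 'b assume "gelfand f = gelfand g"
    then have "x f = x g" if "x \<in> characters" for x
      using that unfolding gelfand_def by (metis restrict_apply')
    then show "f = g"
      by (rule characters_eqI)
  qed
next
  fix u assume "u \<in> range (gelfand :: 'b \<Rightarrow> _)"
  then obtain f :: 'b where u: "u = gelfand f"
    by blast
  have "continuous_on characters u"
    by (rule continuous_on_eq[OF continuous_on_evaluation[of _ f]]) (simp add: u gelfand_def)
  then show "u \<in> cfunctions weak_star_topology"
    by (simp add: cfunctions_weak_star u gelfand_def)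
next
  fix u :: "('b \<Rightarrow> complex) \<Rightarrow> complex"
  assume "u \<in> cfunctions weak_star_topology"
  then have u: "u \<in> extensional characters" "continuous_on characters u"
    by (simp_all add: cfunctions_weak_star)
  have "continuous_on characters (\<lambda>x. Re (u x))" "continuous_on characters (\<lambda>x. Im (u x))"
    using u by (auto intro!: continuous_intros)
  then obtain h k where h: "\<And>x. x \<in> characters \<Longrightarrow> x h = of_real (Re (u x))"
    and k: "\<And>x. x \<in> characters \<Longrightarrow> x k = of_real (Im (u x))"
    using gelfand_real_surj by metis
  have "gelfand (h + \<i> *\<^sub>C k) = u"
  proof (rule extensionalityI[OF _ u(1)])
    show "gelfand (h + \<i> *\<^sub>C k) \<in> extensional characters"
      by (simp add: gelfand_def)
    fix x :: "'b \<Rightarrow> complex" assume x: "x \<in> characters"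
    then show "gelfand (h + \<i> *\<^sub>C k) x = u x"
      by (simp add: gelfand_def character_add character_scaleC h k complex_eq_iff)
  qed
  then show "u \<in> range gelfand"
    by blast
qed

theorem gelfand_isometry:
  "bijective_star_isometry weak_star_topology (gelfand :: 'b::comm_unital_cstar_algebra \<Rightarrow> _)"
  unfolding bijective_star_isometry_def
  using gelfand_bij
  by (simp add: sup_norm_gelfand) (simp add: gelfand_def character_add character_scaleC character_mult character_star)

section \<open>Cones in the algebra\<close>

text \<open>Antisymmetry comes from density: characters agreeing on \<open>C\<close> agree on the
  closure of \<open>C - C\<close>, the hermitian part, hence everywhere. The graph is an
  intersection of closed conditions, one for each element of \<open>C\<close>.\<close>

lemma compact_ordered_space_characters:
  fixes C :: "'b::comm_unital_cstar_algebra set"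
  assumes dense: "closure {f - g | f g. f \<in> C \<and> g \<in> C} = hermitian"
  shows "compact_ordered_space weak_star_topology (character_order C)"
  unfolding compact_ordered_space_def
proof (intro conjI)
  show "compact_space (weak_star_topology :: ('b \<Rightarrow> complex) topology)"
    by (simp add: weak_star_topology_eq compact_space_subtopology compact_characters)
next
  have "x = y" if xy: "(x, y) \<in> character_order C" "(y, x) \<in> character_order C" for x y
  proof -
    have ch: "x \<in> characters" "y \<in> characters"
      and C: "\<And>f. f \<in> C \<Longrightarrow> x f = y f"
      using xy by (auto simp: character_order_def intro: antisym)
    have "closed {f. x f = y f}"
      using linear_continuous_on[OF character_bounded_linear] ch by (intro closed_Collect_eq) auto
    moreover have "{f - g | f g. f \<in> C \<and> g \<in> C} \<subseteq> {f. x f = y f}"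
      using C ch by (auto simp: character_diff)
    ultimately have H: "x h = y h" if "h \<in> hermitian" for h
      using closure_minimal dense that by blast
    show "x = y"
    proof
      fix f
      show "x f = y f"
        using character_re_im[OF ch(1), of f] character_re_im[OF ch(2), of f]
        by (simp add: H re_part_hermitian im_part_hermitian)
    qed
  qed
  then show "partial_order_on (topspace weak_star_topology) (character_order C)"
    unfolding partial_order_on_def preorder_on_def
    by (auto simp: character_order_def refl_on_def antisym_def intro!: transI intro: order_trans)
next
  have "closed {z :: ('b \<Rightarrow> complex) \<times> ('b \<Rightarrow> complex). fst z f \<le> snd z f}" for f
    unfolding less_eq_complex_def
    by (intro closed_Collect_conj closed_Collect_le closed_Collect_eq continuous_intros
        continuous_on_product_then_coordinatewise)
  then have "closed (\<Inter>f\<in>C. {z :: ('b \<Rightarrow> complex) \<times> ('b \<Rightarrow> complex). fst z f \<le> snd z f})"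
    by (intro closed_INT ballI)
  then have "closedin (top_of_set (characters \<times> characters))
      ((characters \<times> characters) \<inter> (\<Inter>f\<in>C. {z. fst z f \<le> snd z f}))"
    by (rule closedin_closed_Int)
  also have "(characters \<times> characters) \<inter> (\<Inter>f\<in>C. {z. fst z f \<le> snd z f}) = character_order C"
    by (auto simp: character_order_def)
  also have "top_of_set (characters \<times> characters) = prod_topology weak_star_topology weak_star_topology"
    by (simp add: weak_star_topology_eq subtopology_Times euclidean_product_topology)
  finally show "closedin (prod_topology weak_star_topology weak_star_topology) (character_order C)" .
qed

theorem theorem2p2:
  fixes C :: "'b::comm_unital_cstar_algebra set"
  assumes add: "\<forall>f\<in>C. \<forall>g\<in>C. f + g \<in> C"
    and scale: "\<forall>a>0. \<forall>f\<in>C. a *\<^sub>R f \<in> C"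
    and closed: "closed C"
    and dense: "closure {f - g | f g. f \<in> C \<and> g \<in> C} = hermitian"
    and stable: "(\<forall>f\<in>C. spectrum f \<subseteq> \<real>\<^sub>\<ge>\<^sub>0 \<and> chi f \<in> C) \<or>
                 (\<forall>f\<in>C. (1 + f) dvd 1 \<and> gam f \<in> C)"
  shows "compact_ordered_space weak_star_topology (character_order C) \<and>
         bijective_star_isometry weak_star_topology (gelfand :: 'b \<Rightarrow> ('b \<Rightarrow> complex) \<Rightarrow> complex) \<and>
         unit_preserving weak_star_topology (gelfand :: 'b \<Rightarrow> ('b \<Rightarrow> complex) \<Rightarrow> complex) \<and>
         bij_betw gelfand C (pos_isotone_functions weak_star_topology (character_order C))"
proof (intro conjI)
  show "compact_ordered_space weak_star_topology (character_order C)"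
    by (rule compact_ordered_space_characters[OF dense])
  show "bijective_star_isometry weak_star_topology (gelfand :: 'b \<Rightarrow> ('b \<Rightarrow> complex) \<Rightarrow> complex)"
    by (rule gelfand_isometry)
  show "unit_preserving weak_star_topology (gelfand :: 'b \<Rightarrow> ('b \<Rightarrow> complex) \<Rightarrow> complex)"
    by (simp add: unit_preserving_def gelfand_def character_one)

  define D where "D = {f - g | f g. f \<in> C \<and> g \<in> C}"
  have D: "closure D = hermitian"
    using dense by (simp add: D_def)
  \<comment> \<open>Density makes \<open>C\<close> nonempty, and \<open>f / (n + 1)\<close> tends to
    0 inside the closed \<open>C\<close>. This also puts \<open>C\<close> inside
    \<open>C - C\<close>, hence inside the hermitian part.\<close>
  have C0: "0 \<in> C"
  proof -
    have "D \<noteq> {}"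
      using D hermitian_zero by force
    then obtain f where f: "f \<in> C"
      by (auto simp: D_def)
    have "(\<lambda>n. inverse (Suc n) *\<^sub>R f) \<longlonglongrightarrow> 0 *\<^sub>R f"
      by (intro tendsto_scaleR LIMSEQ_inverse_real_of_nat tendsto_const)
    moreover have "inverse (Suc n) *\<^sub>R f \<in> C" for n
      using scale f by simp
    ultimately show ?thesis
      using closed_sequentially[OF closed, of "\<lambda>n. inverse (Suc n) *\<^sub>R f"] by simp
  qed
  have C_herm: "C \<subseteq> hermitian"
  proof
    fix f assume "f \<in> C"
    then have "f - 0 \<in> D"
      unfolding D_def using C0 by blast
    then show "f \<in> hermitian"
      using closure_subset[of D] D by auto
  qed
  have nonneg: "0 \<le> Re (x f)" if f: "f \<in> C" and x: "x \<in> characters" for x f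
    using stable
  proof
    assume "\<forall>f\<in>C. spectrum f \<subseteq> \<real>\<^sub>\<ge>\<^sub>0 \<and> chi f \<in> C"
    then have "x f \<in> \<real>\<^sub>\<ge>\<^sub>0"
      using character_spectrum[OF x, of f] f by blast
    then show ?thesis
      by (simp add: complex_nonneg_Reals_iff)
  next
    assume *: "\<forall>f\<in>C. (1 + f) dvd 1 \<and> gam f \<in> C"
    show ?thesis
    proof (rule ccontr)
      \<comment> \<open>If \<open>r\<close> were negative, the multiple \<open>f / (- r)\<close>,
        again in \<open>C\<close>, would take the value \<open>- 1\<close> at \<open>x\<close>, so
        adding 1 could not give an invertible element.\<close>
      define r where "r = Re (x f)"
      assume "\<not> 0 \<le> Re (x f)"
      then have r: "0 < 1 / - r"
        by (simp add: r_def)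
      then have "(1 + (1 / - r) *\<^sub>R f) dvd 1"
        using * scale f by blast
      then obtain k where "1 = (1 + (1 / - r) *\<^sub>R f) * k"
        by (auto simp: dvd_def)
      then have "x 1 = x ((1 + (1 / - r) *\<^sub>R f) * k)"
        by (rule arg_cong)
      then have "x 1 = (x 1 + of_real (1 / - r) * x f) * x k"
        by (simp only: character_mult[OF x] character_add[OF x] character_scaleR[OF x])
      moreover have "x f = of_real r"
        unfolding r_def using character_hermitian_of_real[OF x, of f] f C_herm by blast
      then have "x 1 + of_real (1 / - r) * x f = 0"
        using r by (simp add: character_one[OF x])
      ultimately show False
        by (simp add: character_one[OF x])
    qed
  qed
  \<comment> \<open>The unit is only approximated: \<open>f - g\<close> within \<open>1/2\<close> of
    1 and \<open>g >= 0\<close> on characters give \<open>f >= 1/2\<close> there, hence the factor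
    2.\<close>
  have unit: "\<exists>e\<in>C. \<forall>x\<in>characters. 1 \<le> Re (x e)"
  proof -
    have "1 \<in> closure D"
      by (simp add: D hermitian_one)
    then obtain d where "d \<in> D" "dist d 1 < 1/2"
      using closure_approachable by (metis half_gt_zero zero_less_one)
    then obtain f g where fg: "f \<in> C" "g \<in> C" "norm (f - g - 1) < 1/2"
      by (auto simp: D_def dist_norm)
    have "1 \<le> Re (x (2 *\<^sub>R f))" if x: "x \<in> characters" for x
    proof -
      have "\<bar>Re (x (f - g - 1))\<bar> < 1/2"
        using abs_Re_le_cmod character_norm_le[OF x] fg(3) by (meson le_less_trans)
      moreover have "Re (x (f - g - 1)) = Re (x f) - Re (x g) - 1"
        by (simp add: character_diff[OF x] character_one[OF x])
      ultimately have "1/2 \<le> Re (x f)"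
        using nonneg[OF fg(2) x] by linarith
      then show ?thesis
        by (simp add: character_scaleR[OF x])
    qed
    moreover have "2 *\<^sub>R f \<in> C"
      by (rule scale[rule_format]) (simp_all add: fg(1))
    ultimately show ?thesis
      by blast
  qed
  have "\<exists>p. hermitian_cone p C"
    using stable
  proof
    assume *: "\<forall>f\<in>C. spectrum f \<subseteq> \<real>\<^sub>\<ge>\<^sub>0 \<and> chi f \<in> C"
    have "\<exists>f'\<in>C. \<forall>x\<in>characters. Re (x f') = 2 * (Re (x f))\<^sup>2 / (1 + (Re (x f))\<^sup>2)" if "f \<in> C" for f
      using that * C_herm by (intro bexI[of _ "chi f"]) (auto simp: character_chi)
    then have "hermitian_cone (\<lambda>t. 2 * t\<^sup>2 / (1 + t\<^sup>2)) C"
      by (intro hermitian_cone.intro contracting_map_chi hermitian_cone_axioms.intro)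
        (use closed C_herm C0 add scale nonneg unit in auto)
    then show ?thesis
      by blast
  next
    assume *: "\<forall>f\<in>C. (1 + f) dvd 1 \<and> gam f \<in> C"
    have "\<exists>f'\<in>C. \<forall>x\<in>characters. Re (x f') = (2 * Re (x f) / (1 + Re (x f)))\<^sup>2" if "f \<in> C" for f
      using that * C_herm by (intro bexI[of _ "gam f"]) (auto simp: character_gam)
    then have "hermitian_cone (\<lambda>t. (2 * t / (1 + t))\<^sup>2) C"
      by (intro hermitian_cone.intro contracting_map_gam hermitian_cone_axioms.intro)
        (use closed C_herm C0 add scale nonneg unit in auto)
    then show ?thesis
      by blast
  qed
  then obtain p where cone: "hermitian_cone p C"
    by blast

  have real: "x f = of_real (Re (x f))" if "f \<in> C" "x \<in> characters" for f x
    using character_hermitian_of_real[OF that(2), of f] that(1) C_herm by blast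
  have cont: "continuous_map weak_star_topology euclideanreal h \<longleftrightarrow> continuous_on characters h"
    for h :: "('b \<Rightarrow> complex) \<Rightarrow> real"
    by (simp add: weak_star_topology_eq)
  show "bij_betw gelfand C (pos_isotone_functions weak_star_topology (character_order C))"
    unfolding bij_betw_def
  proof (intro conjI equalityI subsetI)
    show "inj_on gelfand C"
      using gelfand_bij by (auto simp: bij_betw_def intro: inj_on_subset)
  next
    fix u assume "u \<in> gelfand ` C"
    then obtain f where f: "f \<in> C" "u = gelfand f"
      by blast
    have "u = (\<lambda>x\<in>topspace weak_star_topology. complex_of_real (Re (x f)))"
      unfolding f(2) gelfand_def using real[OF f(1)] by (auto simp: restrict_def)
    moreover have "continuous_on characters (\<lambda>x. Re (x f))"
      by (intro continuous_on_Re continuous_on_evaluation)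
    moreover have "isotone_on (topspace weak_star_topology) (character_order C) (\<lambda>x. Re (x f))"
      using f(1) by (auto simp: isotone_on_def character_order_def less_eq_complex_def)
    ultimately show "u \<in> pos_isotone_functions weak_star_topology (character_order C)"
      unfolding pos_isotone_functions_def using nonneg[OF f(1)]
      by (intro CollectI exI[of _ "\<lambda>x. Re (x f)"]) (simp add: cont)
  next
    fix u assume "u \<in> pos_isotone_functions weak_star_topology (character_order C)"
    then obtain g where u: "u = (\<lambda>x\<in>characters. complex_of_real (g x))"
      and g: "continuous_on characters g" "\<And>x. x \<in> characters \<Longrightarrow> 0 \<le> g x"
      and iso: "isotone_on characters (character_order C) g"
      by (auto simp: pos_isotone_functions_def cont)
    \<comment> \<open>Elements of \<open>C\<close> take real values, so if none is strictly smaller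
      at \<open>y\<close> than at \<open>x\<close>, then \<open>x <= y\<close> in
      \<open>character_order C\<close>, and isotony contradicts \<open>g y < g x\<close>.\<close>
    have sep: "\<exists>f\<in>C. Re (y f) < Re (x f)" if xy: "x \<in> characters" "y \<in> characters" "g y < g x" for x y
    proof (rule ccontr)
      assume "\<not> ?thesis"
      then have "\<forall>f\<in>C. x f \<le> y f"
        using C_herm xy(1,2) by (auto simp: less_eq_complex_def not_less character_hermitian)
      then have "g x \<le> g y"
        using iso xy by (auto simp: isotone_on_def character_order_def)
      then show False
        using xy(3) by simp
    qed
    obtain h where h: "h \<in> C" "\<And>x. x \<in> characters \<Longrightarrow> x h = of_real (g x)"
      using hermitian_cone.isotone_represented[OF cone g sep] by blast
    have "gelfand h = u"
      unfolding gelfand_def u by (rule restrict_ext) (rule h(2))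
    then show "u \<in> gelfand ` C"
      using h(1) by blast
  qed
qed

end
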